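(* Let $M$ be a closed, connected, smooth Riemannian manifold of dimension $n\geq 4$, endowed with a volume form with associated measure $\mu$. Then the boundary of the set $\mathcal{A}_{\mu}(M)$ of divergence-free Anosov vector fields on $M$ (in $\mathfrak{X}^1_\mu(M)$) has no isolated points; that is, no $X\in\mathfrak{X}^1_\mu(M)$ is isolated in the boundary of $\mathcal{A}_\mu(M)$.
   Context: $\mathfrak{X}^1_{\mu}(M)$ is the set of $C^1$ divergence-free vector fields on $M$ (with respect to the volume form), with the $C^1$ Whitney topology. For a $C^1$ vector field $X$, $X^t$ denotes its flow. A point is regular if it is not a singularity (zero) of $X$; a set is regular if it contains no singularities. For a regular point $x$, $N_x:=X(x)^{\perp}\subset T_xM$, and the linear Poincaré flow is $P_X^t(x):=\Pi_{X^t(x)}\circ DX^t_x: N_x\to N_{X^t(x)}$, where $\Pi_{y}:T_{y}M\to N_{y}$ is the orthogonal projection. An $X^t$-invariant, compact and regular set $\Lambda\subset M$ is hyperbolic if $N_\Lambda$ has a $P_X^t$-invariant splitting $N_\Lambda=N^s_\Lambda\oplus N^u_\Lambda$ and there is $\ell>0$ such that $\|P_X^{\ell}(x)|_{N^s_x}\|\leq \frac12$ and $\|P_X^{-\ell}(X^{\ell}(x))|_{N^u_{X^\ell(x)}}\|\leq\frac12$ for every $x\in\Lambda$. $X$ is Anosov if $M$ itself is a hyperbolic set. $\mathcal{A}_\mu(M)\subset\mathfrak{X}^1_\mu(M)$ is the ($C^1$-open) set of divergence-free Anosov vector fields. A vector field $X\in\mathfrak{X}^1_\mu(M)$ is isolated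 in the boundary of $\mathcal{A}_\mu(M)$ if $X$ is not Anosov and there is a (small) neighborhood $\mathcal{U}$ of $X$ in $\mathfrak{X}^1_\mu(M)$ such that every $Y\in\mathcal{U}\setminus\{X\}$ is Anosov. *)

theory Defs
  imports "HOL-Analysis.Analysis"
begin

section \<open>Differentiability classes on open subsets of Euclidean spaces\<close>

primrec Ck_on :: "nat \<Rightarrow> 'v::euclidean_space set \<Rightarrow> ('v \<Rightarrow> 'w::real_normed_vector) \<Rightarrow> bool" where
  "Ck_on 0 S f \<longleftrightarrow> continuous_on S f"
| "Ck_on (Suc k) S f \<longleftrightarrow>
     (\<forall>y\<in>S. f differentiable (at y)) \<and> (\<forall>v. Ck_on k S (\<lambda>y. frechet_derivative f (at y) v))"

definition smooth_on :: "'v::euclidean_space set \<Rightarrow> ('v \<Rightarrow> 'w::real_normed_vector) \<Rightarrow> bool" where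
  "smooth_on S f \<longleftrightarrow> (\<forall>k. Ck_on k S f)"


section \<open>Smooth manifolds\<close>

text \<open>The manifold is the whole type \<open>'a\<close>, modelled on \<open>real ^ 'n\<close>. A chart is a pair of a
  domain and a map, whose values outside the domain are irrelevant.\<close>

type_synonym ('a, 'n) chart = "'a set \<times> ('a \<Rightarrow> real ^ 'n)"

definition chart_inv :: "('a, 'n) chart \<Rightarrow> real ^ 'n \<Rightarrow> 'a" where
  "chart_inv c = inv_into (fst c) (snd c)"

definition chart_image :: "('a, 'n) chart \<Rightarrow> (real ^ 'n) set" where
  "chart_image c = snd c ` fst c"

definition smooth_atlas :: "('a::topological_space, 'n::finite) chart set \<Rightarrow> bool" where
  "smooth_atlas A \<longleftrightarrow>
     (\<forall>c\<in>A. open (fst c) \<and> open (chart_image c) \<and>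
        homeomorphism (fst c) (chart_image c) (snd c) (chart_inv c)) \<and>
     (\<Union>c\<in>A. fst c) = UNIV \<and>
     (\<forall>c\<in>A. \<forall>d\<in>A. smooth_on (snd c ` (fst c \<inter> fst d)) (snd d \<circ> chart_inv c))"

definition closed_connected_manifold :: "('a::t2_space, 'n::finite) chart set \<Rightarrow> bool" where
  "closed_connected_manifold A \<longleftrightarrow>
     smooth_atlas A \<and> compact (UNIV :: 'a set) \<and> connected (UNIV :: 'a set)"

text \<open>For each point \<open>x\<close> one chart \<open>chart_at A x\<close> around it is chosen, and the tangent space
  \<open>T\<^sub>xM\<close> is identified with \<open>real ^ 'n\<close> through it. A vector field, metric or form is thus a
  function whose value at \<open>x\<close> is expressed in the coordinates \<open>chart_at A x\<close>. As the chosen chart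
  jumps with \<open>x\<close>, regularity of such an object is always that of its representatives in the charts
  of the atlas. These are obtained with \<open>to_chart\<close>, the differential of a chart \<open>c\<close> as a map
  from \<open>T\<^sub>xM\<close> to \<open>real ^ 'n\<close>, and its inverse \<open>from_chart\<close>.\<close>

definition chart_at :: "('a, 'n) chart set \<Rightarrow> 'a \<Rightarrow> ('a, 'n) chart" where
  "chart_at A x = (SOME c. c \<in> A \<and> x \<in> fst c)"

definition to_chart :: "('a, 'n::finite) chart set \<Rightarrow> ('a, 'n) chart \<Rightarrow> 'a \<Rightarrow> real ^ 'n \<Rightarrow> real ^ 'n" where
  "to_chart A c x =
     frechet_derivative (snd c \<circ> chart_inv (chart_at A x)) (at (snd (chart_at A x) x))"

definition from_chart :: "('a, 'n::finite) chart set \<Rightarrow> ('a, 'n) chart \<Rightarrow> 'a \<Rightarrow> real ^ 'n \<Rightarrow> real ^ 'n" where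
  "from_chart A c x = frechet_derivative (snd (chart_at A x) \<circ> chart_inv c) (at (snd c x))"

definition mfd_deriv ::
  "('a, 'n::finite) chart set \<Rightarrow> ('a \<Rightarrow> 'a) \<Rightarrow> 'a \<Rightarrow> real ^ 'n \<Rightarrow> real ^ 'n" where
  "mfd_deriv A f x =
     frechet_derivative (snd (chart_at A (f x)) \<circ> f \<circ> chart_inv (chart_at A x))
       (at (snd (chart_at A x) x))"


section \<open>Riemannian metrics and volume forms\<close>

definition riemannian_metric ::
  "('a, 'n::finite) chart set \<Rightarrow> ('a \<Rightarrow> real ^ 'n \<Rightarrow> real ^ 'n \<Rightarrow> real) \<Rightarrow> bool" where
  "riemannian_metric A g \<longleftrightarrow>
     (\<forall>x. bilinear (g x) \<and> (\<forall>v w. g x v w = g x w v) \<and> (\<forall>v. v \<noteq> 0 \<longrightarrow> g x v v > 0)) \<and>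
     (\<forall>c\<in>A. \<forall>v w. smooth_on (chart_image c)
        (\<lambda>y. let x = chart_inv c y in g x (from_chart A c x v) (from_chart A c x w)))"

text \<open>The \<open>n\<close> arguments of an \<open>n\<close>-form are the rows of a matrix.\<close>

definition alternating_form :: "(real ^ 'n ^ 'n \<Rightarrow> real) \<Rightarrow> bool" where
  "alternating_form \<alpha> \<longleftrightarrow>
     (\<forall>B k. linear (\<lambda>v. \<alpha> (\<chi> i. if i = k then v else B $ i))) \<and>
     (\<forall>B i j. i \<noteq> j \<and> B $ i = B $ j \<longrightarrow> \<alpha> B = 0)"

definition loc_form ::
  "('a, 'n::finite) chart set \<Rightarrow> ('a \<Rightarrow> real ^ 'n ^ 'n \<Rightarrow> real) \<Rightarrow> ('a, 'n) chart \<Rightarrow>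
   real ^ 'n \<Rightarrow> real ^ 'n ^ 'n \<Rightarrow> real" where
  "loc_form A \<omega> c y B = (let x = chart_inv c y in \<omega> x (\<chi> i. from_chart A c x (B $ i)))"

definition volume_form ::
  "('a, 'n::finite) chart set \<Rightarrow> ('a \<Rightarrow> real ^ 'n ^ 'n \<Rightarrow> real) \<Rightarrow> bool" where
  "volume_form A \<omega> \<longleftrightarrow>
     (\<forall>x. alternating_form (\<omega> x) \<and> (\<exists>B. \<omega> x B \<noteq> 0)) \<and>
     (\<forall>c\<in>A. \<forall>B. smooth_on (chart_image c) (\<lambda>y. loc_form A \<omega> c y B))"


section \<open>Divergence-free vector fields\<close>

definition loc_field ::
  "('a, 'n::finite) chart set \<Rightarrow> ('a \<Rightarrow> real ^ 'n) \<Rightarrow> ('a, 'n) chart \<Rightarrow> real ^ 'n \<Rightarrow> real ^ 'n" where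
  "loc_field A X c y = (let x = chart_inv c y in to_chart A c x (X x))"

definition C1_fields :: "('a, 'n::finite) chart set \<Rightarrow> ('a \<Rightarrow> real ^ 'n) set" where
  "C1_fields A = {X. \<forall>c\<in>A. Ck_on 1 (chart_image c) (loc_field A X c)}"

text \<open>With \<open>\<omega> = \<rho> dy\<^sub>1 \<and> \<dots> \<and> dy\<^sub>n\<close> in a chart, the divergence of \<open>X\<close>, defined by
  \<open>d (i\<^sub>X \<omega>) = (div X) \<omega>\<close>, is \<open>(1 / \<rho>) \<Sum>\<^sub>i \<partial>\<^sub>i (\<rho> X\<^sub>i)\<close>; here \<open>\<rho>\<close> is the value of \<open>\<omega>\<close> on the
  coordinate frame.\<close>

definition density ::
  "('a, 'n::finite) chart set \<Rightarrow> ('a \<Rightarrow> real ^ 'n ^ 'n \<Rightarrow> real) \<Rightarrow> ('a, 'n) chart \<Rightarrow> real ^ 'n \<Rightarrow> real" where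
  "density A \<omega> c y = loc_form A \<omega> c y (\<chi> i. axis i 1)"

definition divergence ::
  "('a, 'n::finite) chart set \<Rightarrow> ('a \<Rightarrow> real ^ 'n ^ 'n \<Rightarrow> real) \<Rightarrow> ('a \<Rightarrow> real ^ 'n) \<Rightarrow>
   ('a, 'n) chart \<Rightarrow> real ^ 'n \<Rightarrow> real" where
  "divergence A \<omega> X c y =
     (\<Sum>i\<in>UNIV. frechet_derivative (\<lambda>z. density A \<omega> c z * loc_field A X c z $ i) (at y) (axis i 1))
       / density A \<omega> c y"

definition div_free_fields ::
  "('a, 'n::finite) chart set \<Rightarrow> ('a \<Rightarrow> real ^ 'n ^ 'n \<Rightarrow> real) \<Rightarrow> ('a \<Rightarrow> real ^ 'n) set" where
  "div_free_fields A \<omega> =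
     {X \<in> C1_fields A. \<forall>c\<in>A. \<forall>y\<in>chart_image c. divergence A \<omega> X c y = 0}"


section \<open>The Whitney topology of class C1\<close>

text \<open>As the manifold is compact, the strong and weak Whitney topologies coincide, and single
  charts with a compact subset of their domain provide a subbasis.\<close>

definition C1_ball ::
  "('a, 'n::finite) chart set \<Rightarrow> ('a \<Rightarrow> real ^ 'n) \<Rightarrow> ('a, 'n) chart \<Rightarrow> 'a set \<Rightarrow> real \<Rightarrow>
   ('a \<Rightarrow> real ^ 'n) set" where
  "C1_ball A X c K e =
     {Y \<in> C1_fields A. \<forall>y\<in>snd c ` K.
        norm (loc_field A Y c y - loc_field A X c y) < e \<and>
        onorm (\<lambda>v. frechet_derivative (loc_field A Y c) (at y) v
                 - frechet_derivative (loc_field A X c) (at y) v) < e}"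

definition C1_topology :: "('a::topological_space, 'n::finite) chart set \<Rightarrow> ('a \<Rightarrow> real ^ 'n) topology" where
  "C1_topology A = topology_generated_by
     {C1_ball A X c K e | X c K e. X \<in> C1_fields A \<and> c \<in> A \<and> compact K \<and> K \<subseteq> fst c \<and> e > 0}"

definition div_free_topology ::
  "('a::topological_space, 'n::finite) chart set \<Rightarrow> ('a \<Rightarrow> real ^ 'n ^ 'n \<Rightarrow> real) \<Rightarrow>
   ('a \<Rightarrow> real ^ 'n) topology" where
  "div_free_topology A \<omega> = subtopology (C1_topology A) (div_free_fields A \<omega>)"


section \<open>Flows and the linear Poincare flow\<close>

text \<open>Continuity of \<open>\<gamma>\<close> at \<open>t\<close> keeps \<open>\<gamma> s\<close> in the domain of the chart for \<open>s\<close> near \<open>t\<close>.\<close>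

definition has_velocity ::
  "('a::topological_space, 'n::finite) chart set \<Rightarrow> (real \<Rightarrow> 'a) \<Rightarrow> real ^ 'n \<Rightarrow> real \<Rightarrow> bool" where
  "has_velocity A \<gamma> v t \<longleftrightarrow>
     isCont \<gamma> t \<and> ((snd (chart_at A (\<gamma> t)) \<circ> \<gamma>) has_vector_derivative v) (at t)"

definition is_flow ::
  "('a::topological_space, 'n::finite) chart set \<Rightarrow> ('a \<Rightarrow> real ^ 'n) \<Rightarrow> (real \<Rightarrow> 'a \<Rightarrow> 'a) \<Rightarrow> bool" where
  "is_flow A X \<Phi> \<longleftrightarrow>
     (\<forall>x. \<Phi> 0 x = x \<and> (\<forall>t. has_velocity A (\<lambda>s. \<Phi> s x) (X (\<Phi> t x)) t))"

text \<open>A C1 vector field on a closed manifold has exactly one (complete) flow.\<close>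

definition flow ::
  "('a::topological_space, 'n::finite) chart set \<Rightarrow> ('a \<Rightarrow> real ^ 'n) \<Rightarrow> real \<Rightarrow> 'a \<Rightarrow> 'a" where
  "flow A X = (THE \<Phi>. is_flow A X \<Phi>)"

definition normal_space ::
  "('a \<Rightarrow> real ^ 'n \<Rightarrow> real ^ 'n \<Rightarrow> real) \<Rightarrow> ('a \<Rightarrow> real ^ 'n) \<Rightarrow> 'a \<Rightarrow> (real ^ 'n) set" where
  "normal_space g X x = {v. g x (X x) v = 0}"

definition normal_proj ::
  "('a \<Rightarrow> real ^ 'n \<Rightarrow> real ^ 'n \<Rightarrow> real) \<Rightarrow> ('a \<Rightarrow> real ^ 'n) \<Rightarrow> 'a \<Rightarrow> real ^ 'n \<Rightarrow> real ^ 'n" where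
  "normal_proj g X x v = v - (g x (X x) v / g x (X x) (X x)) *\<^sub>R X x"

definition poincare_flow ::
  "('a::topological_space, 'n::finite) chart set \<Rightarrow> ('a \<Rightarrow> real ^ 'n \<Rightarrow> real ^ 'n \<Rightarrow> real) \<Rightarrow>
   ('a \<Rightarrow> real ^ 'n) \<Rightarrow> real \<Rightarrow> 'a \<Rightarrow> real ^ 'n \<Rightarrow> real ^ 'n" where
  "poincare_flow A g X t x = normal_proj g X (flow A X t x) \<circ> mfd_deriv A (flow A X t) x"


section \<open>Hyperbolicity\<close>

definition riem_norm :: "('a \<Rightarrow> real ^ 'n \<Rightarrow> real ^ 'n \<Rightarrow> real) \<Rightarrow> 'a \<Rightarrow> real ^ 'n \<Rightarrow> real" where
  "riem_norm g x v = sqrt (g x v v)"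

text \<open>Operator norm of \<open>L\<close> restricted to a subspace \<open>E\<close> of \<open>T\<^sub>xM\<close>, with values in \<open>T\<^sub>yM\<close>.\<close>

definition riem_onorm ::
  "('a \<Rightarrow> real ^ 'n \<Rightarrow> real ^ 'n \<Rightarrow> real) \<Rightarrow> 'a \<Rightarrow> 'a \<Rightarrow> (real ^ 'n) set \<Rightarrow>
   (real ^ 'n \<Rightarrow> real ^ 'n) \<Rightarrow> real" where
  "riem_onorm g x y E L = (SUP v\<in>{v\<in>E. riem_norm g x v \<le> 1}. riem_norm g y (L v))"

definition invariant_splitting ::
  "('a::topological_space, 'n::finite) chart set \<Rightarrow> ('a \<Rightarrow> real ^ 'n \<Rightarrow> real ^ 'n \<Rightarrow> real) \<Rightarrow>
   ('a \<Rightarrow> real ^ 'n) \<Rightarrow> 'a set \<Rightarrow> ('a \<Rightarrow> (real ^ 'n) set) \<Rightarrow> ('a \<Rightarrow> (real ^ 'n) set) \<Rightarrow> bool" where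
  "invariant_splitting A g X \<Lambda> Ns Nu \<longleftrightarrow>
     (\<forall>x\<in>\<Lambda>. subspace (Ns x) \<and> subspace (Nu x) \<and> Ns x \<inter> Nu x = {0} \<and>
        {v + w | v w. v \<in> Ns x \<and> w \<in> Nu x} = normal_space g X x \<and>
        (\<forall>t. poincare_flow A g X t x ` Ns x = Ns (flow A X t x) \<and>
             poincare_flow A g X t x ` Nu x = Nu (flow A X t x)))"

definition hyperbolic_set ::
  "('a::topological_space, 'n::finite) chart set \<Rightarrow> ('a \<Rightarrow> real ^ 'n \<Rightarrow> real ^ 'n \<Rightarrow> real) \<Rightarrow>
   ('a \<Rightarrow> real ^ 'n) \<Rightarrow> 'a set \<Rightarrow> bool" where
  "hyperbolic_set A g X \<Lambda> \<longleftrightarrow>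
     (\<forall>t. flow A X t ` \<Lambda> = \<Lambda>) \<and> compact \<Lambda> \<and> (\<forall>x\<in>\<Lambda>. X x \<noteq> 0) \<and>
     (\<exists>Ns Nu. invariant_splitting A g X \<Lambda> Ns Nu \<and>
       (\<exists>l>0. \<forall>x\<in>\<Lambda>.
          riem_onorm g x (flow A X l x) (Ns x) (poincare_flow A g X l x) \<le> 1 / 2 \<and>
          riem_onorm g (flow A X l x) x (Nu (flow A X l x))
            (poincare_flow A g X (- l) (flow A X l x)) \<le> 1 / 2))"

definition anosov ::
  "('a::topological_space, 'n::finite) chart set \<Rightarrow> ('a \<Rightarrow> real ^ 'n \<Rightarrow> real ^ 'n \<Rightarrow> real) \<Rightarrow>
   ('a \<Rightarrow> real ^ 'n) \<Rightarrow> bool" where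
  "anosov A g X \<longleftrightarrow> hyperbolic_set A g X UNIV"

definition div_free_anosov ::
  "('a::topological_space, 'n::finite) chart set \<Rightarrow> ('a \<Rightarrow> real ^ 'n \<Rightarrow> real ^ 'n \<Rightarrow> real) \<Rightarrow>
   ('a \<Rightarrow> real ^ 'n ^ 'n \<Rightarrow> real) \<Rightarrow> ('a \<Rightarrow> real ^ 'n) set" where
  "div_free_anosov A g \<omega> = {X \<in> div_free_fields A \<omega>. anosov A g X}"

definition isolated_in_anosov_boundary ::
  "('a::topological_space, 'n::finite) chart set \<Rightarrow> ('a \<Rightarrow> real ^ 'n \<Rightarrow> real ^ 'n \<Rightarrow> real) \<Rightarrow>
   ('a \<Rightarrow> real ^ 'n ^ 'n \<Rightarrow> real) \<Rightarrow> ('a \<Rightarrow> real ^ 'n) \<Rightarrow> bool" where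
  "isolated_in_anosov_boundary A g \<omega> X \<longleftrightarrow>
     X \<in> div_free_fields A \<omega> \<and> \<not> anosov A g X \<and>
     (\<exists>U. openin (div_free_topology A \<omega>) U \<and> X \<in> U \<and> (\<forall>Y\<in>U - {X}. Y \<in> div_free_anosov A g \<omega>))"

end

theory Submission
  imports Defs
begin

text \<open>If \<open>X \<noteq> 0\<close> were isolated, then \<open>(1 + s) X\<close> would be Anosov for small \<open>s > 0\<close>; but its flow is a
  constant time change of the flow of \<open>X\<close>, so the linear Poincare flow is merely reparametrized and
  \<open>X\<close> itself would be Anosov. If \<open>X = 0\<close>, then arbitrarily small multiples of a nonzero divergence-free
  field with a singularity lie near \<open>X\<close> and are not Anosov. Such a field is obtained in a single chart
  from the closed 1-form \<open>(max 0 (r\<^sup>2 - |x - y|\<^sup>2))\<^sup>2 \<Sum>\<^sub>k (x\<^sub>k - y\<^sub>k) dx\<^sub>k\<close>, wedged with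
  all but two of the \<open>dx\<^sub>k\<close>: the result is a closed \<open>(n - 1)\<close>-form with compact support, hence
  \<open>i\<^sub>Z \<omega>\<close> for a divergence-free \<open>Z\<close>.\<close>

section \<open>Maps of class C1\<close>

text \<open>The laborious part is the field used for \<open>X = 0\<close>: it is built in one chart,
  but its divergence must vanish in every chart. Passing to another chart multiplies the density by
  a Jacobian determinant and replaces each 1-form by its pullback. The determinants cancel, so
  density times field has the same wedge expression in all charts. The pulled-back forms remain
  closed because second derivatives of transition maps are symmetric, and the divergence of the
  wedge expression is then a symmetric matrix paired with an antisymmetric one, hence zero. The
  1-form of the overview is closed because it equals -1/6 times the differential of
  \<open>(max 0 (r^2 - |x - y|^2))^3\<close>. Its coefficient, a squared positive part, is of class
  C1, which is the regularity demanded of the field. This one factor supplies both the compact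
  support and, at the centre \<open>y\<close>, the singularity; the remaining factors
  \<open>dx_k\<close> are constant.\<close>

declare Ck_on.simps(2) [simp del]

lemma Ck_on_1_iff:
  "Ck_on 1 S f \<longleftrightarrow> (\<forall>y\<in>S. f differentiable (at y)) \<and>
     (\<forall>v. continuous_on S (\<lambda>y. frechet_derivative f (at y) v))"
  by (simp add: Ck_on.simps(2))

lemma Ck_on_1I:
  assumes "\<And>y. y \<in> S \<Longrightarrow> (f has_derivative f' y) (at y)"
    and "\<And>v. continuous_on S (\<lambda>y. f' y v)"
  shows "Ck_on 1 S f"
proof -
  have "frechet_derivative f (at y) = f' y" if "y \<in> S" for y
    using frechet_derivative_at[OF assms(1)[OF that]] by simp
  then show ?thesis
    unfolding Ck_on_1_iff using assms by (auto simp: differentiable_def cong: continuous_on_cong)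
qed

lemma Ck_on_1D:
  assumes "Ck_on 1 S f"
  shows "y \<in> S \<Longrightarrow> (f has_derivative frechet_derivative f (at y)) (at y)"
    and "continuous_on S (\<lambda>y. frechet_derivative f (at y) v)"
    and "continuous_on S f"
proof -
  show "y \<in> S \<Longrightarrow> (f has_derivative frechet_derivative f (at y)) (at y)" for y
    using assms unfolding Ck_on_1_iff by (simp add: frechet_derivative_works)
  then show "continuous_on S f"
    by (metis continuous_at_imp_continuous_on has_derivative_continuous)
  show "continuous_on S (\<lambda>y. frechet_derivative f (at y) v)"
    using assms unfolding Ck_on_1_iff by blast
qed

lemma smooth_on_frechet_derivative:
  "smooth_on S f \<Longrightarrow> smooth_on S (\<lambda>y. frechet_derivative f (at y) v)"
  unfolding smooth_on_def by (metis Ck_on.simps(2))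

lemma smooth_on_imp_Ck_on_1: "smooth_on S f \<Longrightarrow> Ck_on 1 S f"
  unfolding smooth_on_def by blast

lemma Ck_on_1_cong:
  assumes "open S" "Ck_on 1 S f" "\<And>y. y \<in> S \<Longrightarrow> f y = g y"
  shows "Ck_on 1 S g"
proof (rule Ck_on_1I)
  show "(g has_derivative frechet_derivative f (at y)) (at y)" if "y \<in> S" for y
    by (rule has_derivative_transform_within_open[OF Ck_on_1D(1)[OF assms(2) that] assms(1) that])
       (simp add: assms(3))
qed (rule Ck_on_1D(2)[OF assms(2)])

text \<open>Lets a field be examined by one argument on the overlap with a given chart and by
  another away from its support.\<close>

lemma Ck_on_1_local:
  assumes "\<And>y. y \<in> S \<Longrightarrow> \<exists>T. open T \<and> y \<in> T \<and> Ck_on 1 T f"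
  shows "Ck_on 1 S f"
  unfolding Ck_on_1_iff
proof (intro conjI ballI allI)
  show "f differentiable (at y)" if "y \<in> S" for y
    using assms[OF that] unfolding Ck_on_1_iff by blast
  show "continuous_on S (\<lambda>y. frechet_derivative f (at y) v)" for v
  proof (rule continuous_at_imp_continuous_on, rule ballI)
    fix y assume "y \<in> S"
    then obtain T where "open T" "y \<in> T" "Ck_on 1 T f" using assms by blast
    then show "isCont (\<lambda>y. frechet_derivative f (at y) v) y"
      using Ck_on_1D(2) continuous_on_eq_continuous_at by blast
  qed
qed

lemma Ck_on_1_subset: "Ck_on 1 T f \<Longrightarrow> S \<subseteq> T \<Longrightarrow> Ck_on 1 S f"
  unfolding Ck_on_1_iff by (auto intro: continuous_on_subset)

lemma Ck_on_1_const: "Ck_on 1 S (\<lambda>_. c)"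
  by (rule Ck_on_1I[where f' = "\<lambda>_ _. 0"]) auto

lemma Ck_on_1_bounded_linear:
  assumes "bounded_linear h" "Ck_on 1 S f"
  shows "Ck_on 1 S (\<lambda>y. h (f y))"
proof (rule Ck_on_1I)
  show "((\<lambda>y. h (f y)) has_derivative (\<lambda>v. h (frechet_derivative f (at y) v))) (at y)"
    if "y \<in> S" for y
    by (rule bounded_linear.has_derivative[OF assms(1) Ck_on_1D(1)[OF assms(2) that]])
  show "continuous_on S (\<lambda>y. h (frechet_derivative f (at y) v))" for v
    by (rule bounded_linear.continuous_on[OF assms(1) Ck_on_1D(2)[OF assms(2)]])
qed

lemma Ck_on_1_bounded_bilinear:
  assumes "bounded_bilinear p" "Ck_on 1 S f" "Ck_on 1 S g"
  shows "Ck_on 1 S (\<lambda>y. p (f y) (g y))"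
proof (rule Ck_on_1I)
  show "((\<lambda>y. p (f y) (g y)) has_derivative
      (\<lambda>v. p (f y) (frechet_derivative g (at y) v) + p (frechet_derivative f (at y) v) (g y))) (at y)"
    if "y \<in> S" for y
    by (rule bounded_bilinear.FDERIV[OF assms(1) Ck_on_1D(1)[OF assms(2) that] Ck_on_1D(1)[OF assms(3) that]])
  show "continuous_on S
      (\<lambda>y. p (f y) (frechet_derivative g (at y) v) + p (frechet_derivative f (at y) v) (g y))" for v
    by (intro continuous_on_add bounded_bilinear.continuous_on[OF assms(1)]
        Ck_on_1D(2,3)[OF assms(2)] Ck_on_1D(2,3)[OF assms(3)])
qed

lemma Ck_on_1_add:
  assumes "Ck_on 1 S f" "Ck_on 1 S g"
  shows "Ck_on 1 S (\<lambda>y. f y + g y)"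
proof (rule Ck_on_1I)
  show "((\<lambda>y. f y + g y) has_derivative
      (\<lambda>v. frechet_derivative f (at y) v + frechet_derivative g (at y) v)) (at y)"
    if "y \<in> S" for y
    by (rule has_derivative_add[OF Ck_on_1D(1)[OF assms(1) that] Ck_on_1D(1)[OF assms(2) that]])
qed (intro continuous_on_add Ck_on_1D(2) assms)

lemma Ck_on_1_sum:
  assumes "\<And>i. i \<in> I \<Longrightarrow> Ck_on 1 S (f i)"
  shows "Ck_on 1 S (\<lambda>y. \<Sum>i\<in>I. f i y)"
  using assms by (induction I rule: infinite_finite_induct) (auto intro: Ck_on_1_add Ck_on_1_const simp del: One_nat_def)

lemma Ck_on_1_prod:
  fixes f :: "'i \<Rightarrow> 'v::euclidean_space \<Rightarrow> real"
  assumes "\<And>i. i \<in> I \<Longrightarrow> Ck_on 1 S (f i)"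
  shows "Ck_on 1 S (\<lambda>y. \<Prod>i\<in>I. f i y)"
  using assms
  by (induction I rule: infinite_finite_induct)
     (auto intro: Ck_on_1_bounded_bilinear[OF bounded_bilinear_mult] Ck_on_1_const simp del: One_nat_def)

lemma linear_eq_sum_Basis:
  fixes L :: "'v::euclidean_space \<Rightarrow> 'w::real_vector"
  assumes "linear L"
  shows "L v = (\<Sum>b\<in>Basis. (v \<bullet> b) *\<^sub>R L b)"
proof -
  have "L v = L (\<Sum>b\<in>Basis. (v \<bullet> b) *\<^sub>R b)" by (simp add: euclidean_representation)
  then show ?thesis by (simp only: linear_sum[OF assms] linear_scale[OF assms])
qed

text \<open>\<open>Ck_on\<close> gives continuity of the derivative only in a fixed direction.
  Expanding the moving direction \<open>u y\<close> in the basis reduces to finitely many fixed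
  ones.\<close>

lemma Ck_on_1_continuous_on_apply:
  assumes "Ck_on 1 T g" "continuous_on S f" "f ` S \<subseteq> T" "continuous_on S u"
  shows "continuous_on S (\<lambda>y. frechet_derivative g (at (f y)) (u y))"
proof -
  have "frechet_derivative g (at (f y)) (u y) =
      (\<Sum>b\<in>Basis. (u y \<bullet> b) *\<^sub>R frechet_derivative g (at (f y)) b)" if "y \<in> S" for y
    using Ck_on_1D(1)[OF assms(1), of "f y"] assms(3) that
    by (intro linear_eq_sum_Basis has_derivative_linear) auto
  moreover have "continuous_on S (\<lambda>y. \<Sum>b\<in>Basis. (u y \<bullet> b) *\<^sub>R frechet_derivative g (at (f y)) b)"
    by (intro continuous_intros assms continuous_on_compose2[OF Ck_on_1D(2)[OF assms(1)]])
  ultimately show ?thesis by (simp cong: continuous_on_cong)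
qed

lemma Ck_on_1_compose:
  fixes f :: "'v::euclidean_space \<Rightarrow> 'w::euclidean_space"
  assumes "Ck_on 1 S f" "Ck_on 1 T g" "f ` S \<subseteq> T"
  shows "Ck_on 1 S (\<lambda>y. g (f y))"
proof (rule Ck_on_1I)
  show "((\<lambda>y. g (f y)) has_derivative
      (\<lambda>v. frechet_derivative g (at (f y)) (frechet_derivative f (at y) v))) (at y)" if "y \<in> S" for y
    using that assms(3)
    by (intro has_derivative_compose[OF Ck_on_1D(1)[OF assms(1)] Ck_on_1D(1)[OF assms(2)]]) auto
  show "continuous_on S (\<lambda>y. frechet_derivative g (at (f y)) (frechet_derivative f (at y) v))" for v
    by (intro Ck_on_1_continuous_on_apply[OF assms(2)] Ck_on_1D[OF assms(1)] assms(3))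
qed

lemma Ck_on_1_inverse:
  fixes f :: "'v::euclidean_space \<Rightarrow> real"
  assumes "Ck_on 1 S f" "\<And>y. y \<in> S \<Longrightarrow> f y \<noteq> 0"
  shows "Ck_on 1 S (\<lambda>y. inverse (f y))"
proof (rule Ck_on_1I)
  show "((\<lambda>y. inverse (f y)) has_derivative
      (\<lambda>v. - (inverse (f y) * frechet_derivative f (at y) v * inverse (f y)))) (at y)"
    if "y \<in> S" for y
    by (rule Deriv.has_derivative_inverse[OF assms(2)[OF that] Ck_on_1D(1)[OF assms(1) that]])
  show "continuous_on S (\<lambda>y. - (inverse (f y) * frechet_derivative f (at y) v * inverse (f y)))" for v
    by (intro continuous_intros Ck_on_1D[OF assms(1)] ballI assms(2))
qed

lemma Ck_on_1_cartI:
  fixes f :: "'v::euclidean_space \<Rightarrow> real ^ 'n"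
  assumes "\<And>i. Ck_on 1 S (\<lambda>y. f y $ i)"
  shows "Ck_on 1 S f"
proof -
  have "Ck_on 1 S (\<lambda>y. \<Sum>i\<in>UNIV. f y $ i *\<^sub>R (axis i 1 :: real ^ 'n))"
    by (intro Ck_on_1_sum Ck_on_1_bounded_linear[OF bounded_linear_scaleR_left] assms)
  moreover have "(\<lambda>y. \<Sum>i\<in>UNIV. f y $ i *\<^sub>R (axis i 1 :: real ^ 'n)) = f"
    using basis_expansion[of "f _"] by (auto simp: scalar_mult_eq_scaleR)
  ultimately show ?thesis by simp
qed

lemma Ck_on_1_component:
  "Ck_on 1 S f \<Longrightarrow> Ck_on 1 S (\<lambda>y. f y $ i)"
  by (rule Ck_on_1_bounded_linear[OF bounded_linear_vec_nth])

lemma Ck_on_1_det: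
  fixes M :: "'v::euclidean_space \<Rightarrow> real ^ 'n ^ 'n"
  assumes "\<And>k. Ck_on 1 S (\<lambda>y. M y $ k)"
  shows "Ck_on 1 S (\<lambda>y. det (M y))"
  unfolding det_def
  by (intro Ck_on_1_sum Ck_on_1_bounded_linear[OF bounded_linear_mult_right] Ck_on_1_prod
      Ck_on_1_component assms)

text \<open>The double difference is symmetric in \<open>v\<close> and \<open>w\<close>; this is what makes the mixed second
  derivatives agree.\<close>

lemma double_difference_mean_value:
  fixes f :: "'v::real_normed_vector \<Rightarrow> real"
  assumes "t > 0"
    and "\<And>a b. a \<in> {0..t} \<Longrightarrow> b \<in> {0..t} \<Longrightarrow>
      (f has_derivative f' (x + a *\<^sub>R v + b *\<^sub>R w)) (at (x + a *\<^sub>R v + b *\<^sub>R w))"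
    and "\<And>a b. a \<in> {0..t} \<Longrightarrow> b \<in> {0..t} \<Longrightarrow>
      ((\<lambda>z. f' z v) has_derivative f'' (x + a *\<^sub>R v + b *\<^sub>R w)) (at (x + a *\<^sub>R v + b *\<^sub>R w))"
  shows "\<exists>a\<in>{0..t}. \<exists>b\<in>{0..t}.
    f (x + t *\<^sub>R v + t *\<^sub>R w) - f (x + t *\<^sub>R v) - f (x + t *\<^sub>R w) + f x
      = t * t * f'' (x + a *\<^sub>R v + b *\<^sub>R w) w"
proof -
  have d1: "((\<lambda>a. f (x + a *\<^sub>R v + b *\<^sub>R w)) has_real_derivative f' (x + a *\<^sub>R v + b *\<^sub>R w) v) (at a)"
    if "a \<in> {0..t}" "b \<in> {0..t}" for a b
    unfolding has_field_derivative_def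
    by (rule has_derivative_eq_rhs[OF has_derivative_compose[where f = "\<lambda>a. x + a *\<^sub>R v + b *\<^sub>R w" and g = f, OF _ assms(2)[OF that]]],
        auto intro!: derivative_eq_intros simp: linear_scale[OF has_derivative_linear[OF assms(2)[OF that]]] mult_ac)
  have d2: "((\<lambda>b. f' (x + a *\<^sub>R v + b *\<^sub>R w) v) has_real_derivative f'' (x + a *\<^sub>R v + b *\<^sub>R w) w) (at b)"
    if "a \<in> {0..t}" "b \<in> {0..t}" for a b
    unfolding has_field_derivative_def
    by (rule has_derivative_eq_rhs[OF has_derivative_compose[where f = "\<lambda>b. x + a *\<^sub>R v + b *\<^sub>R w" and g = "\<lambda>z. f' z v", OF _ assms(3)[OF that]]],
        auto intro!: derivative_eq_intros simp: linear_scale[OF has_derivative_linear[OF assms(3)[OF that]]] mult_ac)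
  \<comment> \<open>Mean value theorem in direction \<open>v\<close> for the difference between the
    edges at heights \<open>t\<close> and \<open>0\<close> along \<open>w\<close>; below, the same
    in direction \<open>w\<close> for the derivative along \<open>v\<close>. The terms with
    coefficient \<open>0\<close> are kept so that \<open>d1\<close> applies to all four
    corners.\<close>
  have "\<exists>a>0. a < t \<and>
      (f (x + t *\<^sub>R v + t *\<^sub>R w) - f (x + t *\<^sub>R v + 0 *\<^sub>R w)) - (f (x + 0 *\<^sub>R v + t *\<^sub>R w) - f (x + 0 *\<^sub>R v + 0 *\<^sub>R w))
      = (t - 0) * (f' (x + a *\<^sub>R v + t *\<^sub>R w) v - f' (x + a *\<^sub>R v + 0 *\<^sub>R w) v)"
    using assms(1) by (intro MVT2 DERIV_diff d1) auto
  then obtain a where a: "0 < a" "a < t" and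
    "f (x + t *\<^sub>R v + t *\<^sub>R w) - f (x + t *\<^sub>R v) - f (x + t *\<^sub>R w) + f x
      = t * (f' (x + a *\<^sub>R v + t *\<^sub>R w) v - f' (x + a *\<^sub>R v + 0 *\<^sub>R w) v)"
    by (auto simp: algebra_simps)
  moreover have "\<exists>b>0. b < t \<and> f' (x + a *\<^sub>R v + t *\<^sub>R w) v - f' (x + a *\<^sub>R v + 0 *\<^sub>R w) v
      = (t - 0) * f'' (x + a *\<^sub>R v + b *\<^sub>R w) w"
    using assms(1) a by (intro MVT2 d2) auto
  then obtain b where "0 < b" "b < t" "f' (x + a *\<^sub>R v + t *\<^sub>R w) v - f' (x + a *\<^sub>R v + 0 *\<^sub>R w) v
      = t * f'' (x + a *\<^sub>R v + b *\<^sub>R w) w" by auto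
  ultimately show ?thesis
    by (intro bexI[of _ a] bexI[of _ b]) auto
qed

text \<open>One double difference is \<open>t * t\<close> times either mixed derivative, each at
  some point of the same small parallelogram. Dividing by \<open>t * t\<close> and using continuity
  at \<open>x\<close> makes the two values differ by at most any \<open>e > 0\<close>.\<close>

lemma second_derivative_symmetric_real:
  fixes f :: "'v::euclidean_space \<Rightarrow> real"
  assumes "open S" "x \<in> S" and C1: "Ck_on 1 S f"
    and C1': "\<And>v. Ck_on 1 S (\<lambda>z. frechet_derivative f (at z) v)"
  shows "frechet_derivative (\<lambda>z. frechet_derivative f (at z) v) (at x) w =
    frechet_derivative (\<lambda>z. frechet_derivative f (at z) w) (at x) v"
proof -
  define F where "F v w z = frechet_derivative (\<lambda>z. frechet_derivative f (at z) v) (at z) w" for v w z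
  have cont: "isCont (F v w) x" for v w
    using Ck_on_1D(2)[OF C1', of v w] assms(1,2)
    unfolding F_def by (simp add: continuous_on_eq_continuous_at)
  obtain d where d: "d > 0" "ball x d \<subseteq> S"
    using assms(1,2) by (auto simp: open_contains_ball)
  have "\<bar>F v w x - F w v x\<bar> \<le> e" if e: "e > 0" for e
  proof -
    obtain d1 where d1: "d1 > 0" "\<And>z. dist z x < d1 \<Longrightarrow> dist (F v w z) (F v w x) < e / 2"
      using cont[of v w, unfolded continuous_at_eps_delta, rule_format, of "e / 2"] e by auto
    obtain d2 where d2: "d2 > 0" "\<And>z. dist z x < d2 \<Longrightarrow> dist (F w v z) (F w v x) < e / 2"
      using cont[of w v, unfolded continuous_at_eps_delta, rule_format, of "e / 2"] e by auto
    define r where "r = min d (min d1 d2)"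
    \<comment> \<open>Chosen so that the whole parallelogram spanned by \<open>t v\<close> and
      \<open>t w\<close> lies within distance \<open>r\<close> of \<open>x\<close>. The
      \<open>+ 1\<close> covers \<open>v = w = 0\<close>.\<close>
    define t where "t = r / (2 * (norm v + norm w + 1))"
    have r: "r > 0" "r \<le> d" "r \<le> d1" "r \<le> d2" using d d1 d2 by (auto simp: r_def)
    have n: "norm v + norm w + 1 > 0" by (intro add_nonneg_pos add_nonneg_nonneg) auto
    have t: "t > 0" using r n by (simp add: t_def)
    have *: "dist (x + a *\<^sub>R v + b *\<^sub>R w) x < r" if "a \<in> {0..t}" "b \<in> {0..t}" for a b
    proof -
      have "dist (x + a *\<^sub>R v + b *\<^sub>R w) x \<le> norm (a *\<^sub>R v) + norm (b *\<^sub>R w)"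
        using norm_triangle_ineq[of "a *\<^sub>R v" "b *\<^sub>R w"] by (simp add: dist_norm add.assoc)
      also have "\<dots> \<le> t * norm v + t * norm w"
        using that by (intro add_mono) (auto intro: mult_right_mono)
      also have "\<dots> < t * (2 * (norm v + norm w + 1))"
        unfolding distrib_left[symmetric]
      proof (rule mult_strict_left_mono[OF _ t])
        show "norm v + norm w < 2 * (norm v + norm w + 1)" using n by simp
      qed
      also have "\<dots> = r" using n by (simp add: t_def)
      finally show ?thesis .
    qed
    have in_S: "x + a *\<^sub>R v + b *\<^sub>R w \<in> S" if "a \<in> {0..t}" "b \<in> {0..t}" for a b
      using *[OF that] d r by (auto simp: subset_iff dist_commute)
    obtain a b where ab: "a \<in> {0..t}" "b \<in> {0..t}"
      "f (x + t *\<^sub>R v + t *\<^sub>R w) - f (x + t *\<^sub>R v) - f (x + t *\<^sub>R w) + f x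
        = t * t * F v w (x + a *\<^sub>R v + b *\<^sub>R w)"
      using double_difference_mean_value[OF t, of f "\<lambda>z. frechet_derivative f (at z)" x v w
          "\<lambda>z. frechet_derivative (\<lambda>z. frechet_derivative f (at z) v) (at z)"]
        Ck_on_1D(1)[OF C1 in_S] Ck_on_1D(1)[OF C1' in_S] unfolding F_def by auto
    have in_S': "x + a *\<^sub>R w + b *\<^sub>R v \<in> S" if "a \<in> {0..t}" "b \<in> {0..t}" for a b
      using in_S[OF that(2,1)] by (simp add: algebra_simps)
    obtain a' b' where ab': "a' \<in> {0..t}" "b' \<in> {0..t}"
      "f (x + t *\<^sub>R w + t *\<^sub>R v) - f (x + t *\<^sub>R w) - f (x + t *\<^sub>R v) + f x
        = t * t * F w v (x + a' *\<^sub>R w + b' *\<^sub>R v)"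
      using double_difference_mean_value[OF t, of f "\<lambda>z. frechet_derivative f (at z)" x w v
          "\<lambda>z. frechet_derivative (\<lambda>z. frechet_derivative f (at z) w) (at z)"]
        Ck_on_1D(1)[OF C1 in_S'] Ck_on_1D(1)[OF C1' in_S'] unfolding F_def by auto
    have swap: "x + t *\<^sub>R w + t *\<^sub>R v = x + t *\<^sub>R v + t *\<^sub>R w"
      "x + a' *\<^sub>R w + b' *\<^sub>R v = x + b' *\<^sub>R v + a' *\<^sub>R w" by (simp_all add: add_ac)
    have "t * t * F v w (x + a *\<^sub>R v + b *\<^sub>R w)
        = t * t * F w v (x + b' *\<^sub>R v + a' *\<^sub>R w)"
      using ab(3) ab'(3)[unfolded swap] by linarith
    then have "F v w (x + a *\<^sub>R v + b *\<^sub>R w) = F w v (x + b' *\<^sub>R v + a' *\<^sub>R w)"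
      using t by simp
    moreover have "dist (F v w (x + a *\<^sub>R v + b *\<^sub>R w)) (F v w x) < e / 2"
      "dist (F w v (x + b' *\<^sub>R v + a' *\<^sub>R w)) (F w v x) < e / 2"
      using d1 d2 *[OF ab(1,2)] *[OF ab'(2,1)] r by auto
    ultimately show ?thesis unfolding dist_real_def by linarith
  qed
  then have "\<bar>F v w x - F w v x\<bar> \<le> 0" by (rule field_le_epsilon) simp
  then show ?thesis by (simp add: F_def)
qed

lemma second_derivative_symmetric:
  fixes f :: "'v::euclidean_space \<Rightarrow> 'w::euclidean_space"
  assumes "open S" "x \<in> S" "smooth_on S f"
  shows "frechet_derivative (\<lambda>z. frechet_derivative f (at z) v) (at x) w =
    frechet_derivative (\<lambda>z. frechet_derivative f (at z) w) (at x) v"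
proof (rule euclidean_eqI)
  fix b :: 'w assume "b \<in> Basis"
  define h where "h z = f z \<bullet> b" for z
  note C1 = smooth_on_imp_Ck_on_1[OF assms(3)]
  note C1' = smooth_on_imp_Ck_on_1[OF smooth_on_frechet_derivative[OF assms(3)]]
  have h: "frechet_derivative h (at z) = (\<lambda>v. frechet_derivative f (at z) v \<bullet> b)" if "z \<in> S" for z
    unfolding h_def
    by (rule frechet_derivative_at[symmetric],
        rule bounded_linear.has_derivative[OF bounded_linear_inner_left Ck_on_1D(1)[OF C1 that]])
  have h': "((\<lambda>z. frechet_derivative h (at z) v) has_derivative
      (\<lambda>w. frechet_derivative (\<lambda>z. frechet_derivative f (at z) v) (at x) w \<bullet> b)) (at x)" for v
    by (rule has_derivative_transform_within_open[OF _ assms(1,2)],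
        rule bounded_linear.has_derivative[OF bounded_linear_inner_left Ck_on_1D(1)[OF C1' assms(2)]])
       (simp add: h)
  have "Ck_on 1 S h"
    unfolding h_def by (rule Ck_on_1_bounded_linear[OF bounded_linear_inner_left C1])
  moreover have "Ck_on 1 S (\<lambda>z. frechet_derivative h (at z) v)" for v
    by (rule Ck_on_1_cong[OF assms(1) Ck_on_1_bounded_linear[OF bounded_linear_inner_left C1']])
       (simp add: h)
  ultimately show "frechet_derivative (\<lambda>z. frechet_derivative f (at z) v) (at x) w \<bullet> b =
      frechet_derivative (\<lambda>z. frechet_derivative f (at z) w) (at x) v \<bullet> b"
    using second_derivative_symmetric_real[OF assms(1,2), of h v w]
    unfolding frechet_derivative_at[OF h', symmetric] by simp
qed

section \<open>Determinants and alternating forms\<close>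

lemma linear_det_row:
  fixes R :: "'n::finite \<Rightarrow> real ^ 'n"
  shows "linear (\<lambda>v. det (\<chi> i. if i = k then v else R i))"
proof (rule linearI)
  show "det (\<chi> i. if i = k then c *\<^sub>R v else R i) = c *\<^sub>R det (\<chi> i. if i = k then v else R i)" for c v
    using det_row_mul[of k c "\<lambda>_. v" R] by (simp add: scalar_mult_eq_scaleR cong: if_cong)
qed (simp add: det_row_add)

text \<open>Polarization: expand the vanishing determinant that has \<open>u + v\<close> in both
  rows.\<close>

lemma det_row_swap:
  fixes R :: "'n::finite \<Rightarrow> real ^ 'n"
  assumes "i \<noteq> k"
  shows "det (\<chi> j. if j = i then u else if j = k then v else R j) =
    - det (\<chi> j. if j = i then v else if j = k then u else R j)"
proof -
  define F where "F u v = det (\<chi> j. if j = i then u else if j = k then v else R j)" for u v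
  have l1: "linear (\<lambda>u. F u v)" for v
    unfolding F_def by (rule linear_det_row)
  have l2: "linear (F u)" for u
  proof -
    have "(\<chi> j. if j = i then u else if j = k then v else R j) =
        (\<chi> j. if j = k then v else if j = i then u else R j)" for v
      using assms by (simp add: vec_eq_iff)
    then show ?thesis unfolding F_def by (simp add: linear_det_row)
  qed
  have z: "F u u = 0" for u
    unfolding F_def using assms by (intro det_identical_rows[of i k]) (auto simp: row_def vec_eq_iff)
  have "0 = F (u + v) (u + v)" by (simp add: z)
  also have "\<dots> = F u v + F v u"
    unfolding linear_add[OF l1] linear_add[OF l2] by (simp add: z)
  finally have "F u v = - F v u" by linarith
  then show ?thesis unfolding F_def .
qed

text \<open>Leibniz rule in each product of the permutation expansion; exchanging the sum over
  permutations with the sum over the differentiated factor reassembles determinants with one row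
  replaced.\<close>

lemma has_derivative_det:
  fixes M :: "'v::real_normed_vector \<Rightarrow> real ^ 'n ^ 'n"
  assumes "\<And>k. ((\<lambda>z. M z $ k) has_derivative M' k) (at y)"
  shows "((\<lambda>z. det (M z)) has_derivative
    (\<lambda>w. \<Sum>k\<in>UNIV. det (\<chi> j. if j = k then M' k w else M y $ j))) (at y)"
proof -
  have e: "((\<lambda>z. M z $ k $ l) has_derivative (\<lambda>w. M' k w $ l)) (at y)" for k l
    by (rule bounded_linear.has_derivative[OF bounded_linear_vec_nth assms])
  have row: "(\<Prod>j\<in>UNIV. (\<chi> j. if j = k then M' k w else M y $ j) $ j $ p j) =
      M' k w $ p k * (\<Prod>j\<in>UNIV - {k}. M y $ j $ p j)" for k w and p :: "'n \<Rightarrow> 'n"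
    by (subst prod.remove[of UNIV k]) (auto intro!: prod.cong)
  have "((\<lambda>z. det (M z)) has_derivative (\<lambda>w. \<Sum>p\<in>{p. p permutes UNIV}. of_int (sign p) *
      (\<Sum>k\<in>UNIV. M' k w $ p k * (\<Prod>j\<in>UNIV - {k}. M y $ j $ p j)))) (at y)"
    unfolding det_def
    by (intro has_derivative_sum has_derivative_mult_right has_derivative_prod e)
  also have "(\<lambda>w. \<Sum>p\<in>{p. p permutes UNIV}. of_int (sign p) *
      (\<Sum>k\<in>UNIV. M' k w $ p k * (\<Prod>j\<in>UNIV - {k}. M y $ j $ p j))) =
      (\<lambda>w. \<Sum>k\<in>UNIV. det (\<chi> j. if j = k then M' k w else M y $ j))"
    unfolding det_def row sum_distrib_left by (subst sum.swap) simp
  finally show ?thesis .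
qed

text \<open>The rows \<open>R k\<close> are the coefficients of closed 1-forms, and the determinants are the
  components of the vector field corresponding to their exterior product. Its divergence pairs
  the symmetric derivatives of the rows with the antisymmetric determinant.\<close>

lemma divergence_det_closed_rows:
  fixes R :: "'n::finite \<Rightarrow> real ^ 'n \<Rightarrow> real ^ 'n"
  assumes R': "\<And>k. k \<noteq> a \<Longrightarrow> (R k has_derivative R' k) (at y)"
    and sym: "\<And>k v w. k \<noteq> a \<Longrightarrow> v \<bullet> R' k w = w \<bullet> R' k v"
  shows "(\<Sum>i\<in>UNIV. frechet_derivative
    (\<lambda>z. det (\<chi> k. if k = a then axis i 1 else R k z)) (at y) (axis i 1)) = 0"
proof -
  define D where "D k u v = det (\<chi> j. if j = a then u else if j = k then v else R j y)" for k u v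
  have lin: "linear (D k u)" if "k \<noteq> a" for k u
  proof -
    have "(\<chi> j. if j = a then u else if j = k then v else R j y) =
        (\<chi> j. if j = k then v else if j = a then u else R j y)" for v
      using that by (simp add: vec_eq_iff)
    then show ?thesis unfolding D_def by (simp add: linear_det_row)
  qed
  have "frechet_derivative (\<lambda>z. det (\<chi> k. if k = a then axis i 1 else R k z)) (at y) w =
      (\<Sum>k\<in>UNIV - {a}. D k (axis i 1) (R' k w))" for i w
  proof -
    let ?M = "\<lambda>z. \<chi> k. if k = a then axis i 1 else R k z"
    have "((\<lambda>z. ?M z $ k) has_derivative (\<lambda>w. if k = a then 0 else R' k w)) (at y)" for k
      using R'[of k] by (cases "k = a") auto
    from has_derivative_det[of ?M "\<lambda>k w. if k = a then 0 else R' k w", OF this]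
    have "frechet_derivative (\<lambda>z. det (?M z)) (at y) w =
        (\<Sum>k\<in>UNIV. det (\<chi> j. if j = k then if k = a then 0 else R' k w else ?M y $ j))"
      by (simp add: frechet_derivative_at[symmetric])
    \<comment> \<open>Row \<open>a\<close> is constant, so its term is a determinant with a zero
      row.\<close>
    also have "\<dots> = (\<Sum>k\<in>UNIV - {a}. det (\<chi> j. if j = k then if k = a then 0 else R' k w else ?M y $ j))"
    proof (rule sum.mono_neutral_right)
      have "det (\<chi> j. if j = a then 0 else ?M y $ j) = 0"
        using linear_0[OF linear_det_row[of a "\<lambda>j. ?M y $ j"]] .
      then show "\<forall>k\<in>UNIV - (UNIV - {a}).
          det (\<chi> j. if j = k then if k = a then 0 else R' k w else ?M y $ j) = 0"
        by (auto cong: if_cong)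
    qed auto
    also have "\<dots> = (\<Sum>k\<in>UNIV - {a}. D k (axis i 1) (R' k w))"
      unfolding D_def by (intro sum.cong refl arg_cong[where f = det]) (auto simp: vec_eq_iff)
    finally show ?thesis .
  qed
  then have "(\<Sum>i\<in>UNIV. frechet_derivative
      (\<lambda>z. det (\<chi> k. if k = a then axis i 1 else R k z)) (at y) (axis i 1)) =
      (\<Sum>k\<in>UNIV - {a}. \<Sum>i\<in>UNIV. D k (axis i 1) (R' k (axis i 1)))"
    by (simp add: sum.swap[of _ _ "UNIV - {a}"])
  also have "\<dots> = 0"
  proof (rule sum.neutral, rule ballI)
    fix k assume "k \<in> UNIV - {a}"
    then have k: "k \<noteq> a" by simp
    \<comment> \<open>\<open>s\<close> is symmetric because the form \<open>R k\<close> is closed,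
      \<open>d\<close> is antisymmetric because it swaps two rows. Their contraction equals its own
      negative.\<close>
    define s where "s i j = R' k (axis i 1) $ j" for i j
    define d where "d i j = D k (axis i 1) (axis j 1)" for i j
    have s: "s i j = s j i" for i j
      using sym[OF k, of "axis j 1" "axis i 1"] by (simp add: s_def inner_axis')
    have d: "d i j = - d j i" for i j
      unfolding d_def D_def by (rule det_row_swap) (use k in auto)
    have "D k (axis i 1) (R' k (axis i 1)) = (\<Sum>j\<in>UNIV. s i j * d i j)" for i
    proof -
      have "D k (axis i 1) (R' k (axis i 1)) =
          D k (axis i 1) (\<Sum>j\<in>UNIV. s i j *\<^sub>R axis j 1)"
        using basis_expansion[of "R' k (axis i 1)"] by (simp add: s_def scalar_mult_eq_scaleR)
      then show ?thesis
        by (simp add: linear_sum[OF lin[OF k]] linear_scale[OF lin[OF k]] d_def)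
    qed
    then have "(\<Sum>i\<in>UNIV. D k (axis i 1) (R' k (axis i 1))) = (\<Sum>i\<in>UNIV. \<Sum>j\<in>UNIV. s i j * d i j)" (is "?S = _")
      by simp
    also have "\<dots> = (\<Sum>j\<in>UNIV. \<Sum>i\<in>UNIV. s i j * d i j)" by (rule sum.swap)
    also have "\<dots> = (\<Sum>j\<in>UNIV. \<Sum>i\<in>UNIV. - (s j i * d j i))"
    proof (intro sum.cong refl)
      show "s i j * d i j = - (s j i * d j i)" for i j
        unfolding s[of i j] d[of i j] by simp
    qed
    also have "\<dots> = - (\<Sum>i\<in>UNIV. \<Sum>j\<in>UNIV. s i j * d i j)" by (simp add: sum_negf)
    finally show "?S = 0" using \<open>?S = _\<close> by linarith
  qed
  finally show ?thesis .
qed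

section \<open>Alternating n-forms as multiples of the determinant\<close>

lemma alternating_form_row_linear:
  "alternating_form \<alpha> \<Longrightarrow> linear (\<lambda>v. \<alpha> (\<chi> i. if i = k then v else B $ i))"
  unfolding alternating_form_def by blast

lemma alternating_form_same_rows:
  "alternating_form \<alpha> \<Longrightarrow> i \<noteq> j \<Longrightarrow> B $ i = B $ j \<Longrightarrow> \<alpha> B = 0"
  unfolding alternating_form_def by blast

text \<open>The effect of multiplying by a diagonal matrix. Together with row addition (shears) and
  row swaps (transpositions) below, it covers the elementary matrices.\<close>

lemma alternating_form_scale_rows:
  assumes "alternating_form \<alpha>" "finite I"
  shows "\<alpha> (\<chi> i. if i \<in> I then c i *\<^sub>R B $ i else B $ i) = (\<Prod>i\<in>I. c i) * \<alpha> B"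
  using assms(2)
proof induction
  case (insert k I)
  let ?B = "\<chi> i. if i \<in> I then c i *\<^sub>R B $ i else B $ i"
  have "(\<chi> i. if i \<in> insert k I then c i *\<^sub>R B $ i else B $ i) =
      (\<chi> i. if i = k then c k *\<^sub>R B $ k else ?B $ i)"
    by (simp add: vec_eq_iff)
  moreover have "?B = (\<chi> i. if i = k then B $ k else ?B $ i)"
    using insert by (simp add: vec_eq_iff)
  ultimately show ?case
    using insert linear_scale[OF alternating_form_row_linear[OF assms(1), of k ?B], of "c k" "B $ k"]
    by simp
qed simp

lemma alternating_form_row_add:
  assumes "alternating_form \<alpha>" "m \<noteq> n"
  shows "\<alpha> (\<chi> i. if i = m then B $ m + B $ n else B $ i) = \<alpha> B"
proof -
  have "\<alpha> (\<chi> i. if i = m then B $ n else B $ i) = 0"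
    using assms(2) by (intro alternating_form_same_rows[OF assms(1), of m n]) auto
  moreover have "(\<chi> i. if i = m then B $ m else B $ i) = B" by (simp add: vec_eq_iff)
  ultimately show ?thesis
    using linear_add[OF alternating_form_row_linear[OF assms(1), of m B], of "B $ m" "B $ n"] by simp
qed

lemma alternating_form_swap_rows:
  assumes "alternating_form \<alpha>" "m \<noteq> n"
  shows "\<alpha> (\<chi> i. B $ Transposition.transpose m n i) = - \<alpha> B"
proof -
  define F where "F u v = \<alpha> (\<chi> i. if i = m then u else if i = n then v else B $ i)" for u v
  have l1: "linear (\<lambda>u. F u v)" for v
    using alternating_form_row_linear[OF assms(1), of m "\<chi> i. if i = n then v else B $ i"]
    unfolding F_def by (simp cong: if_cong)
  have l2: "linear (F u)" for u
  proof -
    have "(\<chi> i. if i = m then u else if i = n then v else B $ i) =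
        (\<chi> i. if i = n then v else (\<chi> i. if i = m then u else B $ i) $ i)" for v
      using assms(2) by (simp add: vec_eq_iff)
    then show ?thesis
      using alternating_form_row_linear[OF assms(1), of n "\<chi> i. if i = m then u else B $ i"]
      unfolding F_def by (simp cong: if_cong)
  qed
  have z: "F u u = 0" for u
    unfolding F_def using assms(2) by (intro alternating_form_same_rows[OF assms(1), of m n]) auto
  have "0 = F (B $ m + B $ n) (B $ m + B $ n)" by (simp add: z)
  also have "\<dots> = F (B $ m) (B $ n) + F (B $ n) (B $ m)"
    unfolding linear_add[OF l1] linear_add[OF l2] by (simp add: z)
  also have "F (B $ m) (B $ n) = \<alpha> B"
    unfolding F_def by (rule arg_cong[where f = \<alpha>]) (simp add: vec_eq_iff)
  also have "F (B $ n) (B $ m) = \<alpha> (\<chi> i. B $ Transposition.transpose m n i)"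
    unfolding F_def using assms(2)
    by (intro arg_cong[where f = \<alpha>]) (auto simp: vec_eq_iff Transposition.transpose_def)
  finally show ?thesis by linarith
qed

text \<open>Induction over products of elementary matrices: on each of them \<open>\<alpha>\<close>
  reacts to row operations exactly as the determinant does.\<close>

lemma alternating_form_matrix_mult:
  fixes \<alpha> :: "real ^ 'n ^ 'n \<Rightarrow> real"
  assumes "alternating_form \<alpha>"
  shows "\<alpha> (A ** B) = det A * \<alpha> B"
proof -
  \<comment> \<open>\<open>B\<close> is universally quantified because, for a product of two
    matrices, the second factor is absorbed into the argument of the first.\<close>
  have "\<forall>B. \<alpha> (A ** B) = det A * \<alpha> B"
  proof (induction A rule: induct_matrix_elementary_alt)
    case (1 A B)
    then show ?case by (simp add: det_mul matrix_mul_assoc[symmetric])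
  next
    case (2 A i)
    have "\<alpha> (A ** B) = 0" for B
    proof -
      have "(A ** B) = (\<chi> j. if j = i then 0 else (A ** B) $ j)"
        using 2 by (auto simp: vec_eq_iff matrix_matrix_mult_def row_def)
      then show ?thesis
        using linear_0[OF alternating_form_row_linear[OF assms, of i "A ** B"]] by simp
    qed
    moreover have "det A = 0" using 2 by (rule det_zero_row)
    ultimately show ?case by simp
  next
    case (3 A)
    have eq: "A ** B = (\<chi> i. if i \<in> UNIV then A $ i $ i *\<^sub>R B $ i else B $ i)" for B
    proof -
      have "(\<Sum>k\<in>UNIV. A $ i $ k * B $ k $ j) = (\<Sum>k\<in>UNIV. if k = i then A $ i $ i * B $ i $ j else 0)" for i j
        by (rule sum.cong) (auto simp: 3)
      then show ?thesis by (simp add: vec_eq_iff matrix_matrix_mult_def)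
    qed
    have "\<alpha> (A ** B) = (\<Prod>i\<in>UNIV. A $ i $ i) * \<alpha> B" for B
      unfolding eq by (rule alternating_form_scale_rows[OF assms]) simp
    then show ?case by (simp add: det_diagonal[OF 3])
  next
    case (4 m n)
    let ?P = "(\<chi> i j. mat 1 $ i $ Transposition.transpose m n j) :: real ^ 'n ^ 'n"
    have "?P ** B = (\<chi> i. B $ Transposition.transpose m n i)" for B :: "real ^ 'n ^ 'n"
    proof -
      have "(if i = Transposition.transpose m n k then 1 else 0) * B $ k $ j =
          (if k = Transposition.transpose m n i then B $ k $ j else 0)" for i j k
        by (auto simp: Transposition.transpose_def)
      then show ?thesis by (simp add: vec_eq_iff matrix_matrix_mult_def mat_def)
    qed
    moreover have "det ?P = - 1"
    proof -
      have "?P = (\<chi> i j. mat 1 $ Transposition.transpose m n i $ j)"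
        by (auto simp: vec_eq_iff mat_def Transposition.transpose_def)
      then show ?thesis using det_permute_rows[of "Transposition.transpose m n" "mat 1 :: real ^ 'n ^ 'n"] 4
        by (simp add: permutes_swap_id sign_swap_id)
    qed
    ultimately show ?case using alternating_form_swap_rows[OF assms 4] by simp
  next
    case (5 m n)
    let ?P = "(\<chi> i j. of_bool (i = m \<and> j = n \<or> i = j)) :: real ^ 'n ^ 'n"
    have P: "?P ** B = (\<chi> i. if i = m then B $ m + B $ n else B $ i)" for B :: "real ^ 'n ^ 'n"
    proof -
      have "(\<Sum>k\<in>UNIV. of_bool (i = m \<and> k = n \<or> i = k) * B $ k $ j) =
          (\<Sum>k\<in>UNIV. (if k = i then B $ i $ j else 0) + (if k = n then if i = m then B $ n $ j else 0 else 0))" for i j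
        using 5 by (intro sum.cong) auto
      then show ?thesis by (simp add: vec_eq_iff matrix_matrix_mult_def sum.distrib)
    qed
    have "det ?P = 1"
    proof -
      have "?P = (\<chi> i. if i = m then row m (mat 1) + 1 *s row n (mat 1) else row i (mat 1))"
        using P[of "mat 1"] by (simp add: vec_eq_iff row_def)
      then show ?thesis using det_row_operation[OF 5, of "mat 1 :: real ^ 'n ^ 'n" 1] by simp
    qed
    then show ?case using alternating_form_row_add[OF assms 5] P by simp
  qed
  then show ?thesis by blast
qed

section \<open>Charts and the C1 topology\<close>

text \<open>The common form of \<open>to_chart\<close> and \<open>from_chart\<close>, which are the
  cases where one of the two charts is the chosen chart at \<open>x\<close>. The cocycle rules below
  then serve both.\<close>

definition transition_deriv ::
  "('a, 'n::finite) chart \<Rightarrow> ('a, 'n) chart \<Rightarrow> 'a \<Rightarrow> real ^ 'n \<Rightarrow> real ^ 'n" where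
  "transition_deriv c d x = frechet_derivative (snd d \<circ> chart_inv c) (at (snd c x))"

lemma to_chart_eq: "to_chart A c x = transition_deriv (chart_at A x) c x"
  unfolding to_chart_def transition_deriv_def ..

lemma from_chart_eq: "from_chart A c x = transition_deriv c (chart_at A x) x"
  unfolding from_chart_def transition_deriv_def ..

context
  fixes A :: "('a::t2_space, 'n::finite) chart set"
  assumes atlas: "smooth_atlas A"
begin

lemma chart_homeomorphism: "c \<in> A \<Longrightarrow> homeomorphism (fst c) (chart_image c) (snd c) (chart_inv c)"
  using atlas unfolding smooth_atlas_def by blast

lemma open_chart_domain: "c \<in> A \<Longrightarrow> open (fst c)"
  using atlas unfolding smooth_atlas_def by blast

lemma open_chart_image: "c \<in> A \<Longrightarrow> open (chart_image c)"
  using atlas unfolding smooth_atlas_def by blast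

lemma chart_inv_chart: "c \<in> A \<Longrightarrow> x \<in> fst c \<Longrightarrow> chart_inv c (snd c x) = x"
  using chart_homeomorphism homeomorphism_apply1 by metis

lemma chart_chart_inv: "c \<in> A \<Longrightarrow> y \<in> chart_image c \<Longrightarrow> snd c (chart_inv c y) = y"
  using chart_homeomorphism homeomorphism_apply2 by metis

lemma chart_inv_mem: "c \<in> A \<Longrightarrow> y \<in> chart_image c \<Longrightarrow> chart_inv c y \<in> fst c"
  using chart_homeomorphism homeomorphism_image2 by blast

lemma chart_mem_image: "x \<in> fst c \<Longrightarrow> snd c x \<in> chart_image c"
  unfolding chart_image_def by blast

lemma open_chart_preimage:
  assumes "c \<in> A" "open U"
  shows "open (snd c ` (fst c \<inter> U))"
proof -
  have "snd c ` (fst c \<inter> U) = chart_image c \<inter> chart_inv c -` U"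
    using chart_inv_chart[OF assms(1)] chart_chart_inv[OF assms(1)] chart_inv_mem[OF assms(1)]
    by (force simp: chart_image_def)
  also have "open \<dots>"
    using homeomorphism_cont2[OF chart_homeomorphism[OF assms(1)]] open_chart_image[OF assms(1)] assms(2)
    by (rule continuous_open_preimage)
  finally show ?thesis .
qed

lemma open_chart_overlap: "c \<in> A \<Longrightarrow> d \<in> A \<Longrightarrow> open (snd c ` (fst c \<inter> fst d))"
  by (simp add: open_chart_preimage open_chart_domain)

lemma chart_at_mem: "chart_at A x \<in> A" "x \<in> fst (chart_at A x)"
proof -
  have "\<exists>c. c \<in> A \<and> x \<in> fst c"
    using atlas unfolding smooth_atlas_def by blast
  from someI_ex[OF this] show "chart_at A x \<in> A" "x \<in> fst (chart_at A x)"
    unfolding chart_at_def by blast+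
qed

lemma smooth_on_transition:
  "c \<in> A \<Longrightarrow> d \<in> A \<Longrightarrow> smooth_on (snd c ` (fst c \<inter> fst d)) (snd d \<circ> chart_inv c)"
  using atlas unfolding smooth_atlas_def by blast

lemma has_derivative_transition:
  assumes "c \<in> A" "d \<in> A" "x \<in> fst c" "x \<in> fst d"
  shows "((snd d \<circ> chart_inv c) has_derivative transition_deriv c d x) (at (snd c x))"
  unfolding transition_deriv_def
  using assms by (intro Ck_on_1D(1)[OF smooth_on_imp_Ck_on_1[OF smooth_on_transition]]) auto

lemma linear_transition_deriv:
  "c \<in> A \<Longrightarrow> d \<in> A \<Longrightarrow> x \<in> fst c \<Longrightarrow> x \<in> fst d \<Longrightarrow> linear (transition_deriv c d x)"
  using has_derivative_transition has_derivative_linear by blast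

lemma transition_deriv_self:
  assumes "c \<in> A" "x \<in> fst c"
  shows "transition_deriv c c x = (\<lambda>v. v)"
  unfolding transition_deriv_def
proof (rule frechet_derivative_at[symmetric])
  show "((snd c \<circ> chart_inv c) has_derivative (\<lambda>v. v)) (at (snd c x))"
    by (rule has_derivative_transform_within_open[OF has_derivative_ident open_chart_image])
       (use assms in \<open>auto simp: chart_mem_image chart_chart_inv\<close>)
qed

text \<open>Chain rule. The composite through \<open>d\<close> agrees with the direct transition
  only on the overlap with \<open>d\<close>, which is an open neighbourhood of the point and so
  determines the derivative.\<close>

lemma transition_deriv_compose:
  assumes "c \<in> A" "d \<in> A" "e \<in> A" "x \<in> fst c" "x \<in> fst d" "x \<in> fst e"
  shows "transition_deriv d e x (transition_deriv c d x v) = transition_deriv c e x v"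
proof -
  have "((snd e \<circ> chart_inv c) has_derivative
      (\<lambda>v. transition_deriv d e x (transition_deriv c d x v))) (at (snd c x))"
  proof (rule has_derivative_transform_within_open[OF _ open_chart_overlap[OF assms(1,2)]])
    have "(snd d \<circ> chart_inv c) (snd c x) = snd d x"
      using assms by (simp add: chart_inv_chart)
    then have "((snd e \<circ> chart_inv d) has_derivative transition_deriv d e x)
        (at ((snd d \<circ> chart_inv c) (snd c x)))"
      using has_derivative_transition[OF assms(2,3,5,6)] by simp
    with has_derivative_transition[OF assms(1,2,4,5)]
    show "((\<lambda>y. (snd e \<circ> chart_inv d) ((snd d \<circ> chart_inv c) y)) has_derivative
        (\<lambda>v. transition_deriv d e x (transition_deriv c d x v))) (at (snd c x))"
      by (rule has_derivative_compose)
  qed (use assms in \<open>auto simp: chart_inv_chart\<close>)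
  from frechet_derivative_at[OF this] show ?thesis
    unfolding transition_deriv_def by (simp add: fun_eq_iff)
qed

lemma transition_deriv_inverse:
  assumes "c \<in> A" "d \<in> A" "x \<in> fst c" "x \<in> fst d"
  shows "transition_deriv d c x (transition_deriv c d x v) = v"
  using transition_deriv_compose[OF assms(1,2,1,3,4,3)] transition_deriv_self[OF assms(1,3)] by simp

lemma loc_field_chart:
  "c \<in> A \<Longrightarrow> x \<in> fst c \<Longrightarrow> loc_field A X c (snd c x) = transition_deriv (chart_at A x) c x (X x)"
  unfolding loc_field_def by (simp add: chart_inv_chart to_chart_eq)

text \<open>Every neighbour of \<open>X\<close> considered lies on a line \<open>X + s Z\<close>.
  Scalings are included, by \<open>Z = X\<close> with parameter \<open>s - 1\<close> or by
  \<open>X = 0\<close>.\<close>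

lemma loc_field_line:
  assumes "c \<in> A" "y \<in> chart_image c"
  shows "loc_field A (\<lambda>x. X x + s *\<^sub>R Z x) c y = loc_field A X c y + s *\<^sub>R loc_field A Z c y"
proof -
  have "linear (transition_deriv (chart_at A (chart_inv c y)) c (chart_inv c y))"
    by (intro linear_transition_deriv chart_at_mem assms chart_inv_mem)
  then show ?thesis
    unfolding loc_field_def Let_def to_chart_eq by (simp add: linear_add linear_scale)
qed

lemma C1_fieldsD: "X \<in> C1_fields A \<Longrightarrow> c \<in> A \<Longrightarrow> Ck_on 1 (chart_image c) (loc_field A X c)"
  unfolding C1_fields_def by blast

lemma C1_fields_line:
  assumes "X \<in> C1_fields A" "Z \<in> C1_fields A"
  shows "(\<lambda>x. X x + s *\<^sub>R Z x) \<in> C1_fields A"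
  unfolding C1_fields_def
proof (safe)
  fix c assume c: "c \<in> A"
  show "Ck_on 1 (chart_image c) (loc_field A (\<lambda>x. X x + s *\<^sub>R Z x) c)"
  proof (rule Ck_on_1_cong[OF open_chart_image[OF c]])
    show "Ck_on 1 (chart_image c) (\<lambda>y. loc_field A X c y + s *\<^sub>R loc_field A Z c y)"
      using assms c
      by (intro Ck_on_1_add Ck_on_1_bounded_linear[OF bounded_linear_scaleR_right] C1_fieldsD)
  qed (simp add: loc_field_line c)
qed

lemma frechet_derivative_loc_field_line:
  assumes "X \<in> C1_fields A" "Z \<in> C1_fields A" "c \<in> A" "y \<in> chart_image c"
  shows "frechet_derivative (loc_field A (\<lambda>x. X x + s *\<^sub>R Z x) c) (at y) v =
    frechet_derivative (loc_field A X c) (at y) v + s *\<^sub>R frechet_derivative (loc_field A Z c) (at y) v"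
proof -
  have "(loc_field A (\<lambda>x. X x + s *\<^sub>R Z x) c has_derivative
    (\<lambda>v. frechet_derivative (loc_field A X c) (at y) v
      + s *\<^sub>R frechet_derivative (loc_field A Z c) (at y) v)) (at y)"
    by (rule has_derivative_transform_within_open[OF
          has_derivative_add[OF Ck_on_1D(1)[OF C1_fieldsD[OF assms(1,3)] assms(4)]
            has_derivative_scaleR_right[OF Ck_on_1D(1)[OF C1_fieldsD[OF assms(2,3)] assms(4)]]]
          open_chart_image[OF assms(3)] assms(4)])
       (simp add: loc_field_line assms)
  from frechet_derivative_at[OF this] show ?thesis by (simp add: fun_eq_iff)
qed

end

text \<open>Holds without differentiability: both sides choose a witness of one and the same
  predicate.\<close>

lemma frechet_derivative_cong_open:
  assumes "open S" "y \<in> S" "\<And>z. z \<in> S \<Longrightarrow> f z = g z"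
  shows "frechet_derivative f (at y) = frechet_derivative g (at y)"
proof -
  have "(f has_derivative F) (at y) \<longleftrightarrow> (g has_derivative F) (at y)" for F
    using assms has_derivative_transform_within_open[of f F y UNIV S g]
      has_derivative_transform_within_open[of g F y UNIV S f] by auto
  then show ?thesis unfolding frechet_derivative_def by simp
qed

text \<open>On a compact set the strict bound leaves a uniform gap: both functions may be replaced
  by their maxima, after which only a limit in \<open>s\<close> remains.\<close>

lemma eventually_perturbation_less:
  fixes a b :: "'v::topological_space \<Rightarrow> real"
  assumes "compact K" "continuous_on K a" "continuous_on K b" "\<And>y. y \<in> K \<Longrightarrow> a y < e"
  shows "\<forall>\<^sub>F s in nhds 0. \<forall>y\<in>K. a y + \<bar>s\<bar> * b y < e"
proof (cases "K = {}")
  case False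
  obtain p where p: "p \<in> K" "\<And>y. y \<in> K \<Longrightarrow> a y \<le> a p"
    using continuous_attains_sup[OF assms(1) False assms(2)] by blast
  obtain q where q: "q \<in> K" "\<And>y. y \<in> K \<Longrightarrow> b y \<le> b q"
    using continuous_attains_sup[OF assms(1) False assms(3)] by blast
  have "((\<lambda>s. a p + \<bar>s\<bar> * b q) \<longlongrightarrow> a p + \<bar>0\<bar> * b q) (nhds 0)"
    by (intro tendsto_intros) (simp add: filterlim_ident)
  then have "\<forall>\<^sub>F s in nhds 0. a p + \<bar>s\<bar> * b q < e"
    using assms(4)[OF p(1)] by (intro order_tendstoD(2)) simp_all
  then show ?thesis
  proof (rule eventually_mono, intro ballI)
    fix s y assume "a p + \<bar>s\<bar> * b q < e" "y \<in> K"
    moreover have "\<bar>s\<bar> * b y \<le> \<bar>s\<bar> * b q"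
      using q(2)[OF \<open>y \<in> K\<close>] by (intro mult_left_mono) auto
    ultimately show "a y + \<bar>s\<bar> * b y < e" using p(2)[of y] by linarith
  qed
qed simp

text \<open>For linear maps on a finite-dimensional space, pointwise continuity in the parameter is
  continuity in operator norm.\<close>

lemma continuous_on_onorm:
  fixes L :: "'v::t2_space \<Rightarrow> 'w::euclidean_space \<Rightarrow> 'u::real_normed_vector"
  assumes "\<And>y. y \<in> S \<Longrightarrow> bounded_linear (L y)" "\<And>v. continuous_on S (\<lambda>y. L y v)"
  shows "continuous_on S (\<lambda>y. onorm (L y))"
proof -
  have app: "blinfun_apply (Blinfun (L y)) = L y" if "y \<in> S" for y
    by (rule bounded_linear_Blinfun_apply[OF assms(1)[OF that]])
  have "continuous_on S (\<lambda>y. Blinfun (L y))"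
    by (rule continuous_on_blinfun_componentwise)
       (use assms(2) in \<open>simp add: app cong: continuous_on_cong\<close>)
  then have "continuous_on S (\<lambda>y. norm (Blinfun (L y)))" by (rule continuous_on_norm)
  then show ?thesis by (simp add: norm_blinfun.rep_eq app cong: continuous_on_cong)
qed

context
  fixes A :: "('a::t2_space, 'n::finite) chart set"
  assumes atlas: "smooth_atlas A"
begin

text \<open>The centre \<open>X0\<close> may differ from \<open>X\<close>, since a subbasic set
  containing \<open>X\<close> need not be centred there. The gap left by \<open>X\<close> on the
  compact set absorbs \<open>\<bar>s\<bar>\<close> times the size of \<open>Z\<close> and of its
  derivative.\<close>

lemma eventually_line_in_C1_ball:
  assumes XZ: "X \<in> C1_fields A" "Z \<in> C1_fields A" "X0 \<in> C1_fields A"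
    and c: "c \<in> A" and K: "compact K" "K \<subseteq> fst c" and ball: "X \<in> C1_ball A X0 c K e"
  shows "\<forall>\<^sub>F s in nhds 0. (\<lambda>x. X x + s *\<^sub>R Z x) \<in> C1_ball A X0 c K e"
proof -
  have K': "compact (snd c ` K)"
    using homeomorphism_cont1[OF chart_homeomorphism[OF atlas c]] K
    by (meson compact_continuous_image continuous_on_subset)
  have sub: "snd c ` K \<subseteq> chart_image c" using K(2) by (auto simp: chart_image_def)
  note C1 = C1_fieldsD[OF atlas _ c]
  define D where "D X y = frechet_derivative (loc_field A X c) (at y)" for X y
  have D: "bounded_linear (D X y)" if "X \<in> C1_fields A" "y \<in> snd c ` K" for X y
    unfolding D_def using sub that(2)
    by (intro has_derivative_bounded_linear[OF Ck_on_1D(1)[OF C1[OF that(1)]]]) auto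
  have cont: "continuous_on (snd c ` K) (loc_field A X c)"
    "continuous_on (snd c ` K) (\<lambda>y. D X y v)" if "X \<in> C1_fields A" for X v
    unfolding D_def using continuous_on_subset[OF Ck_on_1D(3)[OF C1[OF that]] sub]
      continuous_on_subset[OF Ck_on_1D(2)[OF C1[OF that]] sub] by auto
  have "\<forall>\<^sub>F s in nhds 0. \<forall>y\<in>snd c ` K.
      norm (loc_field A X c y - loc_field A X0 c y) + \<bar>s\<bar> * norm (loc_field A Z c y) < e"
    using ball unfolding C1_ball_def
    by (intro eventually_perturbation_less K' continuous_intros cont XZ) blast
  moreover have "\<forall>\<^sub>F s in nhds 0. \<forall>y\<in>snd c ` K.
      onorm (\<lambda>v. D X y v - D X0 y v) + \<bar>s\<bar> * onorm (D Z y) < e"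
    using ball unfolding C1_ball_def D_def[symmetric]
    by (intro eventually_perturbation_less K' continuous_on_onorm continuous_intros cont XZ
        bounded_linear_sub D) auto
  ultimately show ?thesis
  proof eventually_elim
    fix s
    assume s: "\<forall>y\<in>snd c ` K.
      norm (loc_field A X c y - loc_field A X0 c y) + \<bar>s\<bar> * norm (loc_field A Z c y) < e"
      "\<forall>y\<in>snd c ` K. onorm (\<lambda>v. D X y v - D X0 y v) + \<bar>s\<bar> * onorm (D Z y) < e"
    let ?Y = "\<lambda>x. X x + s *\<^sub>R Z x"
    have "norm (loc_field A ?Y c y - loc_field A X0 c y) < e" if y: "y \<in> snd c ` K" for y
    proof -
      have "loc_field A ?Y c y - loc_field A X0 c y =
          (loc_field A X c y - loc_field A X0 c y) + s *\<^sub>R loc_field A Z c y"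
        using loc_field_line[OF atlas c, of y X s Z] sub y by auto
      also have "norm \<dots> \<le> norm (loc_field A X c y - loc_field A X0 c y) + \<bar>s\<bar> * norm (loc_field A Z c y)"
        by (rule norm_triangle_le) simp
      also have "\<dots> < e" using s(1) y by blast
      finally show ?thesis .
    qed
    moreover have "onorm (\<lambda>v. D ?Y y v - D X0 y v) < e" if y: "y \<in> snd c ` K" for y
    proof -
      have eq: "(\<lambda>v. D ?Y y v - D X0 y v) = (\<lambda>v. (D X y v - D X0 y v) + s *\<^sub>R D Z y v)"
        unfolding D_def
        using frechet_derivative_loc_field_line[OF atlas XZ(1,2) c subsetD[OF sub y], of s]
        by (simp add: algebra_simps)
      have "onorm (\<lambda>v. D ?Y y v - D X0 y v) \<le> onorm (\<lambda>v. D X y v - D X0 y v) + onorm (\<lambda>v. s *\<^sub>R D Z y v)"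
        unfolding eq using y XZ by (intro onorm_triangle bounded_linear_sub bounded_linear_scaleR_const
            bounded_linear_compose[OF bounded_linear_scaleR_right] D) auto
      also have "\<dots> = onorm (\<lambda>v. D X y v - D X0 y v) + \<bar>s\<bar> * onorm (D Z y)"
        using onorm_scaleR[OF D[OF XZ(2) y], of s] by simp
      also have "\<dots> < e" using s(2) y by blast
      finally show ?thesis .
    qed
    ultimately show "?Y \<in> C1_ball A X0 c K e"
      unfolding C1_ball_def D_def using C1_fields_line[OF atlas XZ(1,2)] by blast
  qed
qed

text \<open>Continuity at \<open>s = 0\<close> of the line through \<open>X\<close>. Induction over
  the generation of the topology reduces it to subbasic sets.\<close>

lemma eventually_line_in_openin:
  assumes X: "X \<in> C1_fields A" and Z: "Z \<in> C1_fields A"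
    and U: "openin (C1_topology A) U" and "X \<in> U"
  shows "\<forall>\<^sub>F s in nhds 0. (\<lambda>x. X x + s *\<^sub>R Z x) \<in> U"
proof -
  let ?B = "{C1_ball A X c K e | X c K e. X \<in> C1_fields A \<and> c \<in> A \<and> compact K \<and> K \<subseteq> fst c \<and> e > 0}"
  have "generate_topology_on ?B U"
    using U unfolding C1_topology_def openin_topology_generated_by_iff .
  then show ?thesis using \<open>X \<in> U\<close>
  proof induction
    case (Int a b)
    then show ?case by (simp add: eventually_conj)
  next
    case (UN K)
    then obtain k where "k \<in> K" "X \<in> k" by blast
    then have "\<forall>\<^sub>F s in nhds 0. (\<lambda>x. X x + s *\<^sub>R Z x) \<in> k" using UN by blast
    then show ?case by (rule eventually_mono) (use \<open>k \<in> K\<close> in blast)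
  next
    case (Basis b)
    then show ?case using eventually_line_in_C1_ball[OF X Z] by blast
  qed simp
qed

lemma loc_field_scale:
  "c \<in> A \<Longrightarrow> y \<in> chart_image c \<Longrightarrow> loc_field A (\<lambda>x. s *\<^sub>R X x) c y = s *\<^sub>R loc_field A X c y"
  using loc_field_line[OF atlas, of c y "\<lambda>_. 0" s X] loc_field_line[OF atlas, of c y "\<lambda>_. 0" "1" "\<lambda>_. 0"]
  by simp

lemma Ck_on_1_density: "volume_form A \<omega> \<Longrightarrow> c \<in> A \<Longrightarrow> Ck_on 1 (chart_image c) (density A \<omega> c)"
  unfolding volume_form_def density_def[abs_def] by (intro smooth_on_imp_Ck_on_1) blast

lemma div_free_fields_scale:
  assumes \<omega>: "volume_form A \<omega>" and X: "X \<in> div_free_fields A \<omega>"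
  shows "(\<lambda>x. s *\<^sub>R X x) \<in> div_free_fields A \<omega>"
proof -
  have C1: "X \<in> C1_fields A"
    and div: "\<And>c y. c \<in> A \<Longrightarrow> y \<in> chart_image c \<Longrightarrow> divergence A \<omega> X c y = 0"
    using X unfolding div_free_fields_def by auto
  have "(\<lambda>x. s *\<^sub>R X x) \<in> C1_fields A"
    using C1_fields_line[OF atlas C1 C1, of "s - 1"] by (simp add: algebra_simps)
  moreover have "divergence A \<omega> (\<lambda>x. s *\<^sub>R X x) c y = 0"
    if c: "c \<in> A" and y: "y \<in> chart_image c" for c y
  proof -
    let ?f = "\<lambda>i z. density A \<omega> c z * loc_field A X c z $ i"
    have "frechet_derivative (\<lambda>z. density A \<omega> c z * loc_field A (\<lambda>x. s *\<^sub>R X x) c z $ i) (at y) =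
        (\<lambda>v. s * frechet_derivative (?f i) (at y) v)" for i
    proof -
      have "Ck_on 1 (chart_image c) (?f i)"
        by (intro Ck_on_1_bounded_bilinear[OF bounded_bilinear_mult] Ck_on_1_density[OF \<omega> c]
            Ck_on_1_component C1_fieldsD[OF atlas C1 c])
      from has_derivative_mult_right[OF Ck_on_1D(1)[OF this y], of s]
      have "((\<lambda>z. density A \<omega> c z * loc_field A (\<lambda>x. s *\<^sub>R X x) c z $ i) has_derivative
          (\<lambda>v. s * frechet_derivative (?f i) (at y) v)) (at y)"
        by (rule has_derivative_transform_within_open[OF _ open_chart_image[OF atlas c] y])
           (simp add: loc_field_scale c)
      then show ?thesis by (rule frechet_derivative_at[symmetric])
    qed
    then have "divergence A \<omega> (\<lambda>x. s *\<^sub>R X x) c y = s * divergence A \<omega> X c y"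
      unfolding divergence_def by (simp add: sum_distrib_left)
    then show ?thesis by (simp add: div[OF c y])
  qed
  ultimately show ?thesis unfolding div_free_fields_def by blast
qed

end

section \<open>Uniqueness and time change of flows\<close>

text \<open>The function \<open>\<bar>w t\<bar>^2 exp (- 2 L t)\<close> is nonnegative,
  nonincreasing and starts at 0.\<close>

lemma gronwall_zero:
  fixes w :: "real \<Rightarrow> 'v::real_inner"
  assumes "a \<le> b"
    and deriv: "\<And>t. t \<in> {a..b} \<Longrightarrow> (w has_vector_derivative w' t) (at t)"
    and bound: "\<And>t. t \<in> {a..b} \<Longrightarrow> norm (w' t) \<le> L * norm (w t)"
    and "w a = 0"
  shows "w b = 0"
proof -
  define h where "h t = (w t \<bullet> w t) * exp (- 2 * L * t)" for t
  have "h b \<le> h a"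
  proof (rule DERIV_nonpos_imp_nonincreasing[OF assms(1)])
    fix t assume "a \<le> t" "t \<le> b"
    then have t: "t \<in> {a..b}" by simp
    have ww: "((\<lambda>t. w t \<bullet> w t) has_real_derivative 2 * (w t \<bullet> w' t)) (at t)"
      using has_derivative_inner[OF deriv[OF t, unfolded has_vector_derivative_def]
          deriv[OF t, unfolded has_vector_derivative_def]]
      unfolding has_field_derivative_def
      by (rule has_derivative_eq_rhs) (simp add: fun_eq_iff inner_commute algebra_simps)
    have "(h has_real_derivative
        2 * (w t \<bullet> w' t) * exp (- 2 * L * t) + exp (- 2 * L * t) * (- 2 * L) * (w t \<bullet> w t)) (at t)"
      unfolding h_def by (rule DERIV_mult[OF ww]) (auto intro!: derivative_eq_intros)
    moreover have "w t \<bullet> w' t \<le> L * (w t \<bullet> w t)"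
    proof -
      have "w t \<bullet> w' t \<le> norm (w t) * norm (w' t)" by (rule norm_cauchy_schwarz)
      also have "\<dots> \<le> norm (w t) * (L * norm (w t))"
        by (intro mult_left_mono bound t) simp
      also have "\<dots> = L * (w t \<bullet> w t)" by (simp add: power2_norm_eq_inner[symmetric] power2_eq_square)
      finally show ?thesis .
    qed
    then have "2 * exp (- 2 * L * t) * (w t \<bullet> w' t - L * (w t \<bullet> w t)) \<le> 0"
      by (intro mult_nonneg_nonpos) auto
    then have "2 * (w t \<bullet> w' t) * exp (- 2 * L * t) + exp (- 2 * L * t) * (- 2 * L) * (w t \<bullet> w t) \<le> 0"
      by (simp add: algebra_simps)
    ultimately show "\<exists>y. DERIV h t :> y \<and> y \<le> 0" by blast
  qed
  then have "(w b \<bullet> w b) * exp (- 2 * L * b) \<le> 0" by (simp add: h_def \<open>w a = 0\<close>)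
  then have "w b \<bullet> w b \<le> 0" by (simp add: mult_le_0_iff)
  then show ?thesis using inner_gt_zero_iff[of "w b"] by linarith
qed

lemma isCont_eventually_nhds:
  assumes "isCont \<gamma> t" "open U" "\<gamma> t \<in> U"
  shows "\<forall>\<^sub>F s in nhds t. \<gamma> s \<in> U"
  using assms unfolding isCont_def tendsto_at_iff_tendsto_nhds by (rule topological_tendstoD)

text \<open>A C1 right-hand side is Lipschitz on a small closed ball around the initial value, where
  both solutions stay for a short time; Gronwall applies to their difference.\<close>

lemma autonomous_ode_unique_local:
  fixes F :: "'v::euclidean_space \<Rightarrow> 'v" and u v :: "real \<Rightarrow> 'v"
  assumes S: "open S" "Ck_on 1 S F"
    and u: "\<forall>\<^sub>F t in nhds t0. (u has_vector_derivative F (u t)) (at t)"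
    and v: "\<forall>\<^sub>F t in nhds t0. (v has_vector_derivative F (v t)) (at t)"
    and init: "u t0 = v t0" "u t0 \<in> S"
  shows "\<forall>\<^sub>F t in nhds t0. u t = v t"
proof -
  obtain r where r: "r > 0" "cball (u t0) r \<subseteq> S"
    using S(1) init(2) open_contains_cball by blast
  let ?B = "cball (u t0) r"
  have D: "(F has_derivative frechet_derivative F (at y)) (at y)" if "y \<in> ?B" for y
    using Ck_on_1D(1)[OF S(2)] r(2) that by blast
  have "continuous_on ?B (\<lambda>y. onorm (frechet_derivative F (at y)))"
    by (intro continuous_on_onorm has_derivative_bounded_linear[OF D]
        continuous_on_subset[OF Ck_on_1D(2)[OF S(2)] r(2)])
  from continuous_attains_sup[OF compact_cball _ this] r(1) obtain L where
    L: "\<And>y. y \<in> ?B \<Longrightarrow> onorm (frechet_derivative F (at y)) \<le> L" by force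
  have lip: "norm (F y - F z) \<le> L * norm (y - z)" if "y \<in> ?B" "z \<in> ?B" for y z
    by (rule differentiable_bound[OF convex_cball has_derivative_at_withinI[OF D] L that])
  have cont: "isCont u t0" "isCont v t0"
    using eventually_nhds_x_imp_x[OF u] eventually_nhds_x_imp_x[OF v]
    by (auto intro: has_vector_derivative_continuous)
  have "\<forall>\<^sub>F t in nhds t0. u t \<in> ball (u t0) r" "\<forall>\<^sub>F t in nhds t0. v t \<in> ball (u t0) r"
    by (rule isCont_eventually_nhds[OF _ open_ball], simp add: cont, simp add: r(1) init(1))+
  with u v have "\<forall>\<^sub>F t in nhds t0. (u has_vector_derivative F (u t)) (at t) \<and>
      (v has_vector_derivative F (v t)) (at t) \<and> u t \<in> ?B \<and> v t \<in> ?B"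
    by eventually_elim auto
  then obtain d where d: "d > 0" "\<And>t. dist t t0 < d \<Longrightarrow> (u has_vector_derivative F (u t)) (at t) \<and>
      (v has_vector_derivative F (v t)) (at t) \<and> u t \<in> ?B \<and> v t \<in> ?B"
    unfolding eventually_nhds_metric by blast
  have "u t = v t" if t: "dist t t0 < d" for t
  proof (cases "t0 \<le> t")
    case True
    have "u t - v t = 0"
    proof (rule gronwall_zero[OF True, where w = "\<lambda>s. u s - v s"])
      fix s assume "s \<in> {t0..t}"
      then have s: "dist s t0 < d" using t by (auto simp: dist_real_def)
      show "((\<lambda>s. u s - v s) has_vector_derivative F (u s) - F (v s)) (at s)"
        using d(2)[OF s] by (intro has_vector_derivative_diff) auto
      show "norm (F (u s) - F (v s)) \<le> L * norm (u s - v s)"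
        using d(2)[OF s] by (intro lip) auto
    qed (simp add: init)
    then show ?thesis by simp
  next
    case False
    \<comment> \<open>Gronwall runs forward only, so times before \<open>t0\<close> are reached by
      reversing time on \<open>[- t0, - t]\<close>.\<close>
    have "u (- (- t)) - v (- (- t)) = 0"
    proof (rule gronwall_zero[where a = "- t0" and b = "- t" and w = "\<lambda>s. u (- s) - v (- s)"])
      fix s assume "s \<in> {- t0..- t}"
      then have s: "dist (- s) t0 < d" using t by (auto simp: dist_real_def)
      have neg: "((\<lambda>s. x (- s)) has_vector_derivative - y) (at s)"
        if "(x has_vector_derivative y) (at (- s))" for x :: "real \<Rightarrow> 'v" and y
        using vector_diff_chain_at[OF has_vector_derivative_minus[OF has_vector_derivative_id] that]
        by (simp add: o_def)
      have "((\<lambda>s. u (- s) - v (- s)) has_vector_derivative (- F (u (- s)) - - F (v (- s)))) (at s)"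
        using d(2)[OF s] by (intro has_vector_derivative_diff neg) auto
      then show "((\<lambda>s. u (- s) - v (- s)) has_vector_derivative - (F (u (- s)) - F (v (- s)))) (at s)"
        by simp
      show "norm (- (F (u (- s)) - F (v (- s)))) \<le> L * norm (u (- s) - v (- s))"
        unfolding norm_minus_cancel using d(2)[OF s] by (intro lip) auto
    qed (use False in \<open>auto simp: init\<close>)
    then show ?thesis by simp
  qed
  then show ?thesis using d(1) unfolding eventually_nhds_metric by blast
qed

section \<open>Flows on the manifold\<close>

context
  fixes A :: "('a::t2_space, 'n::finite) chart set"
  assumes atlas: "smooth_atlas A"
begin

text \<open>\<open>has_velocity\<close> speaks only of the chosen chart at
  \<open>\<gamma> t\<close>, which jumps along the curve. Expressing the velocity in a fixed chart
  turns the flow equation into an ordinary differential equation in Euclidean space.\<close>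

lemma has_velocity_in_chart:
  assumes vel: "has_velocity A \<gamma> (X (\<gamma> t)) t" and c: "c \<in> A" "\<gamma> t \<in> fst c"
  shows "((\<lambda>s. snd c (\<gamma> s)) has_vector_derivative loc_field A X c (snd c (\<gamma> t))) (at t)"
proof -
  let ?d = "chart_at A (\<gamma> t)"
  let ?T = "transition_deriv ?d c (\<gamma> t)"
  note d = chart_at_mem[OF atlas, of "\<gamma> t"]
  have "isCont \<gamma> t" and
    v: "((snd ?d \<circ> \<gamma>) has_derivative (\<lambda>h. h *\<^sub>R X (\<gamma> t))) (at t)"
    using vel unfolding has_velocity_def has_vector_derivative_def by auto
  then have "\<forall>\<^sub>F s in nhds t. \<gamma> s \<in> fst ?d"
    by (intro isCont_eventually_nhds open_chart_domain[OF atlas] d)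
  then obtain S where S: "open S" "t \<in> S" "\<And>s. s \<in> S \<Longrightarrow> \<gamma> s \<in> fst ?d"
    unfolding eventually_nhds by blast
  have "((snd c \<circ> chart_inv ?d) has_derivative ?T) (at ((snd ?d \<circ> \<gamma>) t))"
    using has_derivative_transition[OF atlas d(1) c(1) d(2) c(2)] by simp
  from has_derivative_compose[OF v this]
  have "((\<lambda>s. (snd c \<circ> chart_inv ?d) ((snd ?d \<circ> \<gamma>) s)) has_derivative
      (\<lambda>h. ?T (h *\<^sub>R X (\<gamma> t)))) (at t)" .
  then have "((\<lambda>s. snd c (\<gamma> s)) has_derivative (\<lambda>h. ?T (h *\<^sub>R X (\<gamma> t)))) (at t)"
    by (rule has_derivative_transform_within_open[OF _ S(1,2)])
       (simp add: chart_inv_chart[OF atlas d(1) S(3)])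
  also have "(\<lambda>h. ?T (h *\<^sub>R X (\<gamma> t))) = (\<lambda>h. h *\<^sub>R loc_field A X c (snd c (\<gamma> t)))"
    using linear_transition_deriv[OF atlas d(1) c(1) d(2) c(2)]
    by (simp add: linear_scale loc_field_chart[OF atlas c])
  finally show ?thesis unfolding has_vector_derivative_def .
qed

text \<open>The times at which two orbits of \<open>x\<close> coincide form a set that is closed
  (the space is Hausdorff), open (local uniqueness in a chart) and contains 0, hence all of the
  line.\<close>

lemma is_flow_unique:
  assumes X: "X \<in> C1_fields A" and "is_flow A X \<Phi>" "is_flow A X \<Psi>"
  shows "\<Phi> = \<Psi>"
proof -
  have "\<Phi> t x = \<Psi> t x" for t x
  proof -
    have vel: "has_velocity A (\<lambda>s. \<Phi> s x) (X (\<Phi> s x)) s" "has_velocity A (\<lambda>s. \<Psi> s x) (X (\<Psi> s x)) s"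
      and init: "\<Phi> 0 x = \<Psi> 0 x" for s
      using assms(2,3) unfolding is_flow_def by simp_all
    then have cont: "isCont (\<lambda>s. \<Phi> s x) s" "isCont (\<lambda>s. \<Psi> s x) s" for s
      unfolding has_velocity_def by blast+
    let ?E = "{s. \<Phi> s x = \<Psi> s x}"
    have "closed ?E"
      by (intro closed_Collect_eq continuous_at_imp_continuous_on ballI cont)
    moreover have "open ?E"
    proof (subst open_subopen, rule ballI)
      fix s assume "s \<in> ?E"
      then have eq: "\<Phi> s x = \<Psi> s x" by simp
      let ?c = "chart_at A (\<Phi> s x)"
      note c = chart_at_mem[OF atlas, of "\<Phi> s x"]
      have near: "\<forall>\<^sub>F r in nhds s. \<Phi> r x \<in> fst ?c" "\<forall>\<^sub>F r in nhds s. \<Psi> r x \<in> fst ?c"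
        by (rule isCont_eventually_nhds[OF _ open_chart_domain[OF atlas c(1)]],
            simp add: cont, use eq c(2) in simp)+
      have "\<forall>\<^sub>F r in nhds s. snd ?c (\<Phi> r x) = snd ?c (\<Psi> r x)"
      proof (rule autonomous_ode_unique_local[OF open_chart_image[OF atlas c(1)] C1_fieldsD[OF atlas X c(1)]])
        show "\<forall>\<^sub>F r in nhds s. ((\<lambda>r. snd ?c (\<Phi> r x)) has_vector_derivative
            loc_field A X ?c (snd ?c (\<Phi> r x))) (at r)"
          using near(1) by eventually_elim
            (rule has_velocity_in_chart[where X = X and \<gamma> = "\<lambda>r. \<Phi> r x", OF vel(1) c(1)])
        show "\<forall>\<^sub>F r in nhds s. ((\<lambda>r. snd ?c (\<Psi> r x)) has_vector_derivative
            loc_field A X ?c (snd ?c (\<Psi> r x))) (at r)"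
          using near(2) by eventually_elim
            (rule has_velocity_in_chart[where X = X and \<gamma> = "\<lambda>r. \<Psi> r x", OF vel(2) c(1)])
      qed (use eq chart_mem_image[OF atlas c(2)] in simp_all)
      with near have "\<forall>\<^sub>F r in nhds s. \<Phi> r x = \<Psi> r x"
        by eventually_elim (metis chart_inv_chart[OF atlas c(1)])
      then show "\<exists>T. open T \<and> s \<in> T \<and> T \<subseteq> ?E"
        unfolding eventually_nhds by blast
    qed
    ultimately have "?E = {} \<or> ?E = UNIV" using clopen[of ?E] by blast
    then show ?thesis using init by blast
  qed
  then show ?thesis by blast
qed

lemma is_flow_scale:
  assumes "is_flow A X \<Phi>"
  shows "is_flow A (\<lambda>x. s *\<^sub>R X x) (\<lambda>t. \<Phi> (s * t))"
  unfolding is_flow_def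
proof (intro allI conjI)
  fix x t
  show "\<Phi> (s * 0) x = x" using assms unfolding is_flow_def by simp
  have vel: "isCont (\<lambda>r. \<Phi> r x) (s * t)"
    "((snd (chart_at A (\<Phi> (s * t) x)) \<circ> (\<lambda>r. \<Phi> r x)) has_vector_derivative X (\<Phi> (s * t) x)) (at (s * t))"
    using assms unfolding is_flow_def has_velocity_def by blast+
  have "((*) s has_vector_derivative s) (at t)"
    by (auto intro!: derivative_eq_intros)
  from vector_diff_chain_at[OF this vel(2)]
  show "has_velocity A (\<lambda>r. \<Phi> (s * r) x) (s *\<^sub>R X (\<Phi> (s * t) x)) t"
    unfolding has_velocity_def o_def using vel(1)
    by (auto intro: isCont_o2[where f = "(*) s"])
qed

text \<open>If \<open>X\<close> had no flow, both sides would be the same unspecified value of \<open>THE\<close>; hence the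
  existence of flows is not needed: \<open>r = 1\<close> works in that case, and \<open>r = 1 / s\<close> otherwise.\<close>

lemma flow_scale:
  assumes X: "X \<in> C1_fields A" and "s > 0"
  shows "\<exists>r>0. \<forall>t. flow A X t = flow A (\<lambda>x. s *\<^sub>R X x) (r * t)"
proof (cases "\<exists>\<Phi>. is_flow A X \<Phi>")
  case True
  then obtain \<Phi> where \<Phi>: "is_flow A X \<Phi>" by blast
  let ?Y = "\<lambda>x. s *\<^sub>R X x"
  have Y: "?Y \<in> C1_fields A"
    using C1_fields_line[OF atlas X X, of "s - 1"] by (simp add: algebra_simps)
  have "flow A X = \<Phi>"
    unfolding flow_def by (rule the_equality[where P = "is_flow A X", OF \<Phi> is_flow_unique[OF X _ \<Phi>]])
  moreover have "flow A ?Y = (\<lambda>t. \<Phi> (s * t))"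
    unfolding flow_def
    by (rule the_equality[where P = "is_flow A ?Y", OF is_flow_scale[OF \<Phi>] is_flow_unique[OF Y _ is_flow_scale[OF \<Phi>]]])
  ultimately show ?thesis using \<open>s > 0\<close> by (intro exI[of _ "1 / s"]) auto
next
  case False
  \<comment> \<open>The time change by \<open>1 / s\<close> would turn a flow of \<open>s X\<close>
    back into one of \<open>X\<close>.\<close>
  have "\<not> is_flow A (\<lambda>x. s *\<^sub>R X x) \<Phi>" for \<Phi>
    using False is_flow_scale[of "\<lambda>x. s *\<^sub>R X x" \<Phi> "1 / s"] \<open>s > 0\<close> by auto
  with False show ?thesis by (intro exI[of _ 1]) (simp add: flow_def)
qed

text \<open>The splitting of the multiple serves \<open>X\<close> unchanged, because normal spaces
  and projections depend only on the direction of the field. Only the contraction time is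
  rescaled.\<close>

lemma anosov_of_anosov_scale:
  assumes X: "X \<in> C1_fields A" and g: "riemannian_metric A g" and "s > 0"
    and anosov: "anosov A g (\<lambda>x. s *\<^sub>R X x)"
  shows "anosov A g X"
proof -
  let ?Y = "\<lambda>x. s *\<^sub>R X x"
  obtain r where r: "r > 0" "\<And>t. flow A X t = flow A ?Y (r * t)"
    using flow_scale[OF X \<open>s > 0\<close>] by blast
  have lin: "linear (\<lambda>v. g x v w)" for x w
    using g unfolding riemannian_metric_def bilinear_def by blast
  have lin': "linear (g x v)" for x v
    using g unfolding riemannian_metric_def bilinear_def by blast
  have space: "normal_space g ?Y = normal_space g X"
    using \<open>s > 0\<close> by (auto simp: normal_space_def fun_eq_iff linear_scale[OF lin])
  \<comment> \<open>The factor \<open>s\<close> occurs twice in the numerator (once from the vector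
    itself) and twice in the denominator.\<close>
  have proj: "normal_proj g ?Y = normal_proj g X"
    using \<open>s > 0\<close> by (simp add: normal_proj_def fun_eq_iff linear_scale[OF lin] linear_scale[OF lin'])
  have P: "poincare_flow A g X t = poincare_flow A g ?Y (r * t)" for t
    unfolding poincare_flow_def proj r(2) ..
  obtain Ns Nu l where l: "l > 0" and split: "invariant_splitting A g ?Y UNIV Ns Nu"
    and contr: "\<And>x. riem_onorm g x (flow A ?Y l x) (Ns x) (poincare_flow A g ?Y l x) \<le> 1 / 2"
      "\<And>x. riem_onorm g (flow A ?Y l x) x (Nu (flow A ?Y l x))
        (poincare_flow A g ?Y (- l) (flow A ?Y l x)) \<le> 1 / 2"
    using anosov unfolding anosov_def hyperbolic_set_def by auto
  have "invariant_splitting A g X UNIV Ns Nu"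
    using split unfolding invariant_splitting_def space P r(2) by simp
  \<comment> \<open>Time \<open>l / r\<close> for \<open>X\<close> is time \<open>l\<close> for the
    multiple.\<close>
  moreover have l': "l / r > 0" "r * (l / r) = l" "r * (- (l / r)) = - l" using l r(1) by auto
  moreover have "\<forall>x\<in>UNIV.
      riem_onorm g x (flow A X (l / r) x) (Ns x) (poincare_flow A g X (l / r) x) \<le> 1 / 2 \<and>
      riem_onorm g (flow A X (l / r) x) x (Nu (flow A X (l / r) x))
        (poincare_flow A g X (- (l / r)) (flow A X (l / r) x)) \<le> 1 / 2"
    unfolding P r(2) l' using contr by simp
  moreover have "\<forall>t. flow A X t ` UNIV = UNIV" "compact (UNIV :: 'a set)" "\<forall>x\<in>UNIV. X x \<noteq> 0"
    using anosov unfolding anosov_def hyperbolic_set_def r(2) by simp_all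
  ultimately show ?thesis
    unfolding anosov_def hyperbolic_set_def by blast
qed

end

section \<open>A divergence-free field with compact support\<close>

text \<open>At 0 the difference quotient is bounded by \<open>\<bar>h\<bar>\<close>. The derivative
  is continuous, so this is a C1 cutoff.\<close>

lemma has_real_derivative_max_0_squared:
  "((\<lambda>t. (max 0 t)\<^sup>2) has_real_derivative 2 * max 0 t) (at t)"
proof -
  consider "t > 0" | "t < 0" | "t = 0" by linarith
  then show ?thesis
  proof cases
    case 1
    have "((\<lambda>t. t\<^sup>2) has_real_derivative 2 * max 0 t) (at t)"
      using 1 by (auto intro!: derivative_eq_intros)
    then show ?thesis
      by (rule has_field_derivative_transform_within_open[of _ _ _ "{0<..}"]) (use 1 in auto)
  next
    case 2
    have "((\<lambda>t. 0) has_real_derivative 2 * max 0 t) (at t)"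
      using 2 by (auto intro!: derivative_eq_intros)
    then show ?thesis
      by (rule has_field_derivative_transform_within_open[of _ _ _ "{..<0}"]) (use 2 in auto)
  next
    case 3
    have "((\<lambda>h :: real. (max 0 h)\<^sup>2 / h) \<longlongrightarrow> 0) (at 0)"
    proof (rule Lim_null_comparison[where g = abs])
      have "norm ((max 0 h)\<^sup>2 / h) \<le> \<bar>h\<bar>" for h :: real
        by (cases "h > 0") (auto simp: power2_eq_square)
      then show "\<forall>\<^sub>F h :: real in at 0. norm ((max 0 h)\<^sup>2 / h) \<le> \<bar>h\<bar>" by simp
    qed (rule tendsto_rabs_zero[OF tendsto_ident_at])
    then show ?thesis using 3 by (simp add: DERIV_def)
  qed
qed

section \<open>Exterior products of covectors under change of coordinates\<close>

lemma alternating_form_compose: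
  fixes \<alpha> :: "real ^ 'n ^ 'n \<Rightarrow> real" and L :: "real ^ 'n \<Rightarrow> real ^ 'n"
  assumes "alternating_form \<alpha>" "linear L"
  shows "alternating_form (\<lambda>B. \<alpha> (\<chi> i. L (B $ i)))"
  unfolding alternating_form_def
proof (intro conjI allI impI)
  fix B :: "real ^ 'n ^ 'n" and k
  have "(\<lambda>v. \<alpha> (\<chi> i. L ((\<chi> i. if i = k then v else B $ i) $ i))) =
      (\<lambda>v. \<alpha> (\<chi> i. if i = k then v else (\<chi> i. L (B $ i)) $ i)) \<circ> L"
    by (auto simp: fun_eq_iff intro!: arg_cong[where f = \<alpha>] simp: vec_eq_iff)
  then show "linear (\<lambda>v. \<alpha> (\<chi> i. L ((\<chi> i. if i = k then v else B $ i) $ i)))"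
    using linear_compose[OF assms(2) alternating_form_row_linear[OF assms(1), of k "\<chi> i. L (B $ i)"]]
    by simp
next
  fix B :: "real ^ 'n ^ 'n" and i j :: 'n
  assume "i \<noteq> j \<and> B $ i = B $ j"
  then show "\<alpha> (\<chi> i. L (B $ i)) = 0"
    by (intro alternating_form_same_rows[OF assms(1), of i j]) auto
qed

lemma alternating_form_eq_det:
  fixes \<alpha> :: "real ^ 'n ^ 'n \<Rightarrow> real"
  assumes "alternating_form \<alpha>"
  shows "\<alpha> B = det B * \<alpha> (\<chi> i. axis i 1)"
proof -
  have eq: "(\<chi> i. axis i 1) = (mat 1 :: real ^ 'n ^ 'n)"
    by (simp add: vec_eq_iff mat_def axis_def)
  show ?thesis
    unfolding eq using alternating_form_matrix_mult[OF assms, of B "mat 1"] by simp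
qed

text \<open>In coordinates with density 1, the vector \<open>Z\<close> for which \<open>i\<^sub>Z \<omega>\<close> is, up to sign, the exterior
  product of the covectors \<open>N k\<close> over all \<open>k \<noteq> a\<close>.\<close>

definition wedge_coords :: "'n::finite \<Rightarrow> ('n \<Rightarrow> real ^ 'n) \<Rightarrow> real ^ 'n" where
  "wedge_coords a N = (\<chi> i. det (\<chi> k. if k = a then axis i 1 else N k))"

lemma wedge_coords_zero: "b \<noteq> a \<Longrightarrow> N b = 0 \<Longrightarrow> wedge_coords a N = 0"
  by (auto simp: wedge_coords_def vec_eq_iff row_def intro!: det_zero_row[of b])

text \<open>Linearity in row \<open>a\<close>. Describing the vector through its pairing with an
  arbitrary covector \<open>u\<close> makes its behaviour under linear maps computable by one
  determinant.\<close>

lemma inner_wedge_coords: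
  "u \<bullet> wedge_coords a N = det (\<chi> k. if k = a then u else N k)"
proof -
  let ?D = "\<lambda>u. det (\<chi> k. if k = a then u else N k)"
  have "u = (\<Sum>i\<in>UNIV. u $ i *\<^sub>R axis i 1)"
    using basis_expansion[of u] by (simp add: scalar_mult_eq_scaleR)
  then have "?D u = ?D (\<Sum>i\<in>UNIV. u $ i *\<^sub>R axis i 1)" by (rule arg_cong)
  also have "\<dots> = (\<Sum>i\<in>UNIV. u $ i * ?D (axis i 1))"
    by (simp add: linear_sum[OF linear_det_row] linear_scale[OF linear_det_row])
  finally show ?thesis by (simp add: wedge_coords_def inner_vec_def)
qed

text \<open>Multiplying by \<open>matrix S\<close> on the right pulls every row back along
  \<open>S\<close>, and the determinant of the product splits. The factor
  \<open>det (matrix S)\<close> is later matched by the change of density.\<close>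

lemma wedge_coords_transform:
  assumes inv: "\<And>v. T (S v) = v" and lin: "linear S" "linear T"
  shows "det (matrix S) *\<^sub>R T (wedge_coords a N) = wedge_coords a (\<lambda>k. \<chi> j. N k \<bullet> S (axis j 1))"
proof (rule vec_eq_iff[THEN iffD2], rule allI)
  fix i
  \<comment> \<open>The \<open>i\<close>-th row of the matrix of \<open>T\<close>; as
    \<open>T\<close> inverts \<open>S\<close>, its pullback along \<open>S\<close> is the
    \<open>i\<close>-th coordinate covector.\<close>
  define u where "u = (\<chi> j. T (axis j 1) $ i)"
  have T: "T v $ i = u \<bullet> v" for v
  proof -
    have "T v = T (\<Sum>j\<in>UNIV. v $ j *\<^sub>R axis j 1)"
      using basis_expansion[of v] by (simp add: scalar_mult_eq_scaleR)
    then show ?thesis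
      by (simp add: linear_sum[OF lin(2)] linear_scale[OF lin(2)] u_def inner_vec_def mult.commute)
  qed
  have "(\<chi> k. if k = a then u else N k) ** matrix S =
      (\<chi> k. if k = a then axis i 1 else \<chi> j. N k \<bullet> S (axis j 1))"
  proof -
    have "((\<chi> k. if k = a then u else N k) ** matrix S) $ k $ l =
        (if k = a then u \<bullet> S (axis l 1) else N k \<bullet> S (axis l 1))" for k l
      by (simp add: matrix_matrix_mult_def matrix_def inner_vec_def)
    moreover have "u \<bullet> S (axis l 1) = axis i 1 $ l" for l
      unfolding T[symmetric] inv by (simp add: axis_def)
    ultimately show ?thesis by (simp add: vec_eq_iff)
  qed
  then have "wedge_coords a (\<lambda>k. \<chi> j. N k \<bullet> S (axis j 1)) $ i =
      det (\<chi> k. if k = a then u else N k) * det (matrix S)"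
    unfolding wedge_coords_def det_mul[symmetric] by simp
  then show "(det (matrix S) *\<^sub>R T (wedge_coords a N)) $ i =
      wedge_coords a (\<lambda>k. \<chi> j. N k \<bullet> S (axis j 1)) $ i"
    by (simp add: T inner_wedge_coords mult.commute)
qed

text \<open>A covector field is closed as a 1-form iff its derivative is symmetric; \<open>R\<close> is the pullback
  of \<open>N\<close> along \<open>\<sigma>\<close>.\<close>

lemma pullback_closed_form:
  fixes N :: "real ^ 'n::finite \<Rightarrow> real ^ 'n" and \<sigma> :: "real ^ 'n \<Rightarrow> real ^ 'n"
  assumes N: "Ck_on 1 UNIV N"
    and sym: "\<And>x v w. v \<bullet> frechet_derivative N (at x) w = w \<bullet> frechet_derivative N (at x) v"
    and \<sigma>: "open S" "smooth_on S \<sigma>"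
    and R: "R = (\<lambda>y. \<chi> j. N (\<sigma> y) \<bullet> frechet_derivative \<sigma> (at y) (axis j 1))"
  shows "Ck_on 1 S R"
    and "y \<in> S \<Longrightarrow> v \<bullet> frechet_derivative R (at y) w = w \<bullet> frechet_derivative R (at y) v"
proof -
  note C1 = smooth_on_imp_Ck_on_1[OF \<sigma>(2)]
  note C1' = smooth_on_imp_Ck_on_1[OF smooth_on_frechet_derivative[OF \<sigma>(2)]]
  define r where "r j y = N (\<sigma> y) \<bullet> frechet_derivative \<sigma> (at y) (axis j 1)" for j y
  have "Ck_on 1 S (r j)" for j
    unfolding r_def
    by (intro Ck_on_1_bounded_bilinear[OF bounded_bilinear_inner] Ck_on_1_compose[OF C1 N] C1') simp
  then show RC1: "Ck_on 1 S R"
    unfolding R r_def by (intro Ck_on_1_cartI) simp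
  assume y: "y \<in> S"
  let ?D = "frechet_derivative \<sigma> (at y)"
  let ?D2 = "\<lambda>v. frechet_derivative (\<lambda>z. frechet_derivative \<sigma> (at z) v) (at y)"
  let ?N' = "frechet_derivative N (at (\<sigma> y))"
  have lin: "linear ?D" "linear (?D2 v)" for v
    using Ck_on_1D(1)[OF C1 y] Ck_on_1D(1)[OF C1' y] has_derivative_linear by blast+
  have comp: "v = (\<Sum>j\<in>UNIV. v $ j *\<^sub>R axis j 1)" for v :: "real ^ 'n"
    using basis_expansion[of v] by (simp add: scalar_mult_eq_scaleR)
  \<comment> \<open>The first summand is symmetric in \<open>v\<close> and \<open>w\<close> by
    symmetry of the second derivative of \<open>\<sigma>\<close>, the second because
    \<open>N\<close> is closed.\<close>
  have *: "v \<bullet> frechet_derivative R (at y) w = N (\<sigma> y) \<bullet> ?D2 w v + ?N' (?D w) \<bullet> ?D v" for v w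
  proof -
    have "frechet_derivative R (at y) w $ j = N (\<sigma> y) \<bullet> ?D2 w (axis j 1) + ?N' (?D w) \<bullet> ?D (axis j 1)" for j
    proof -
      have "((\<lambda>z. R z $ j) has_derivative
          (\<lambda>w. N (\<sigma> y) \<bullet> ?D2 (axis j 1) w + ?N' (?D w) \<bullet> ?D (axis j 1))) (at y)"
        unfolding R vec_lambda_beta
        by (rule has_derivative_inner[OF has_derivative_compose[OF Ck_on_1D(1)[OF C1 y] Ck_on_1D(1)[OF N UNIV_I]]
            Ck_on_1D(1)[OF C1' y]])
      moreover have "((\<lambda>z. R z $ j) has_derivative (\<lambda>w. frechet_derivative R (at y) w $ j)) (at y)"
        by (rule bounded_linear.has_derivative[OF bounded_linear_vec_nth Ck_on_1D(1)[OF RC1 y]])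
      ultimately have "(\<lambda>w. frechet_derivative R (at y) w $ j) =
          (\<lambda>w. N (\<sigma> y) \<bullet> ?D2 (axis j 1) w + ?N' (?D w) \<bullet> ?D (axis j 1))"
        by (rule has_derivative_unique[rotated])
      \<comment> \<open>The arguments of the second derivative are exchanged here so that the basis
        vector stands in the slot where linearity is at hand for the summation over
        \<open>j\<close>.\<close>
      then show ?thesis
        by (simp add: fun_eq_iff second_derivative_symmetric[OF \<sigma>(1) y \<sigma>(2), of "axis j 1" w])
    qed
    then have "v \<bullet> frechet_derivative R (at y) w =
        (\<Sum>j\<in>UNIV. v $ j * (N (\<sigma> y) \<bullet> ?D2 w (axis j 1) + ?N' (?D w) \<bullet> ?D (axis j 1)))"
      by (simp add: inner_vec_def)
    also have "\<dots> = N (\<sigma> y) \<bullet> ?D2 w (\<Sum>j\<in>UNIV. v $ j *\<^sub>R axis j 1) + ?N' (?D w) \<bullet> ?D (\<Sum>j\<in>UNIV. v $ j *\<^sub>R axis j 1)"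
      by (simp add: linear_sum[OF lin(1)] linear_scale[OF lin(1)] linear_sum[OF lin(2)] linear_scale[OF lin(2)]
          inner_sum_right distrib_left sum.distrib)
    finally show ?thesis unfolding comp[of v, symmetric] .
  qed
  show "v \<bullet> frechet_derivative R (at y) w = w \<bullet> frechet_derivative R (at y) v"
    unfolding * second_derivative_symmetric[OF \<sigma>(1) y \<sigma>(2), of w v]
    using sym[of "?D v" "\<sigma> y" "?D w"] by (simp add: inner_commute)
qed

section \<open>The divergence-free field on the manifold\<close>

context
  fixes A :: "('a::t2_space, 'n::finite) chart set"
    and \<omega> :: "'a \<Rightarrow> real ^ 'n ^ 'n \<Rightarrow> real"
  assumes atlas: "smooth_atlas A" and vol: "volume_form A \<omega>"
begin

lemma density_eq:
  assumes "c \<in> A" "x \<in> fst c"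
  shows "density A \<omega> c (snd c x) = \<omega> x (\<chi> i. transition_deriv c (chart_at A x) x (axis i 1))"
  unfolding density_def loc_form_def Let_def by (simp add: chart_inv_chart[OF atlas] assms from_chart_eq)

lemma alternating_form_chart:
  assumes "c \<in> A" "x \<in> fst c"
  shows "alternating_form (\<lambda>B. \<omega> x (\<chi> i. transition_deriv c (chart_at A x) x (B $ i)))"
  using vol unfolding volume_form_def
  by (intro alternating_form_compose linear_transition_deriv[OF atlas] assms chart_at_mem[OF atlas]) blast

lemma density_transition:
  assumes c: "c \<in> A" "x \<in> fst c" and d: "d \<in> A" "x \<in> fst d"
  shows "density A \<omega> d (snd d x) = det (matrix (transition_deriv d c x)) * density A \<omega> c (snd c x)"
proof -
  note e = chart_at_mem[OF atlas, of x]
  \<comment> \<open>The form takes its arguments as rows, whereas \<open>matrix\<close> stores the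
    images of basis vectors as columns; hence the transpose.\<close>
  have "density A \<omega> d (snd d x) =
      \<omega> x (\<chi> i. transition_deriv c (chart_at A x) x (transpose (matrix (transition_deriv d c x)) $ i))"
    unfolding density_eq[OF d]
    by (intro arg_cong[where f = "\<omega> x"])
       (simp add: vec_eq_iff transpose_def matrix_def vec_lambda_eta
        transition_deriv_compose[OF atlas d(1) c(1) e(1) d(2) c(2) e(2)])
  also have "\<dots> = det (matrix (transition_deriv d c x)) * density A \<omega> c (snd c x)"
    using alternating_form_eq_det[OF alternating_form_chart[OF c]] by (simp add: density_eq[OF c] det_transpose)
  finally show ?thesis .
qed

text \<open>The value of an alternating form on any frame is a multiple of its value on the
  coordinate frame, so a zero density would make \<open>\<omega> x\<close> vanish
  identically.\<close>

lemma density_nonzero: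
  assumes c: "c \<in> A" "x \<in> fst c"
  shows "density A \<omega> c (snd c x) \<noteq> 0"
proof
  assume 0: "density A \<omega> c (snd c x) = 0"
  note e = chart_at_mem[OF atlas, of x]
  obtain B where B: "\<omega> x B \<noteq> 0" using vol unfolding volume_form_def by blast
  have "\<omega> x B = \<omega> x (\<chi> i. transition_deriv c (chart_at A x) x
      ((\<chi> i. transition_deriv (chart_at A x) c x (B $ i)) $ i))"
    by (simp add: transition_deriv_inverse[OF atlas e(1) c(1) e(2) c(2)] vec_lambda_eta)
  also have "\<dots> = 0"
    using alternating_form_eq_det[OF alternating_form_chart[OF c], of "\<chi> i. transition_deriv (chart_at A x) c x (B $ i)"]
      0 by (simp add: density_eq[OF c])
  finally show False using B by simp
qed

text \<open>Division by the density yields the vector field whose contraction with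
  \<open>\<omega>\<close> is, up to sign, the product of the 1-forms \<open>N k\<close>,
  \<open>k \<noteq> a\<close>, given in the chart \<open>c\<close>. Extension by 0 is regular once
  one factor has compact support in the chart.\<close>

definition wedge_field ::
  "('a, 'n) chart \<Rightarrow> 'n \<Rightarrow> ('n \<Rightarrow> real ^ 'n \<Rightarrow> real ^ 'n) \<Rightarrow> 'a \<Rightarrow> real ^ 'n" where
  "wedge_field c a N x = (if x \<in> fst c
     then from_chart A c x ((1 / density A \<omega> c (snd c x)) *\<^sub>R wedge_coords a (\<lambda>k. N k (snd c x)))
     else 0)"

text \<open>The Jacobian determinant from the density and the one from
  \<open>wedge_coords_transform\<close> agree, so the expression keeps its shape in every chart,
  with the covectors pulled back.\<close>

lemma loc_field_wedge_field:
  assumes c: "c \<in> A" "x \<in> fst c" and d: "d \<in> A" "x \<in> fst d"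
  shows "density A \<omega> d (snd d x) *\<^sub>R loc_field A (wedge_field c a N) d (snd d x) =
    wedge_coords a (\<lambda>k. \<chi> j. N k (snd c x) \<bullet> transition_deriv d c x (axis j 1))"
proof -
  note e = chart_at_mem[OF atlas, of x]
  let ?T = "transition_deriv c d x"
  note T = linear_transition_deriv[OF atlas c(1) d(1) c(2) d(2)]
    and S = linear_transition_deriv[OF atlas d(1) c(1) d(2) c(2)]
  have "loc_field A (wedge_field c a N) d (snd d x) =
      ?T ((1 / density A \<omega> c (snd c x)) *\<^sub>R wedge_coords a (\<lambda>k. N k (snd c x)))"
    using transition_deriv_compose[OF atlas c(1) e(1) d(1) c(2) e(2) d(2)]
    by (simp add: loc_field_chart[OF atlas d] wedge_field_def c(2) from_chart_eq)
  also have "\<dots> = (1 / density A \<omega> c (snd c x)) *\<^sub>R ?T (wedge_coords a (\<lambda>k. N k (snd c x)))"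
    by (rule linear_scale[OF T])
  finally have "density A \<omega> d (snd d x) *\<^sub>R loc_field A (wedge_field c a N) d (snd d x) =
      det (matrix (transition_deriv d c x)) *\<^sub>R ?T (wedge_coords a (\<lambda>k. N k (snd c x)))"
    using density_nonzero[OF c] by (simp add: density_transition[OF c d])
  also have "\<dots> = wedge_coords a (\<lambda>k. \<chi> j. N k (snd c x) \<bullet> transition_deriv d c x (axis j 1))"
    by (rule wedge_coords_transform[OF transition_deriv_inverse[OF atlas d(1) c(1) d(2) c(2)] S T])
  finally show ?thesis .
qed

text \<open>Two kinds of points: on the domain of \<open>c\<close> the field comes from closed
  pulled-back rows, and elsewhere it vanishes in a neighbourhood. The condition
  \<open>b \<noteq> a\<close> ensures that the compactly supported row enters the product.\<close>

lemma wedge_field_div_free: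
  assumes c: "c \<in> A" and "b \<noteq> a" and K: "compact K" "K \<subseteq> chart_image c"
    and supp: "\<And>x. x \<notin> K \<Longrightarrow> N b x = 0"
    and N: "\<And>k. Ck_on 1 UNIV (N k)"
    and sym: "\<And>k x v w. v \<bullet> frechet_derivative (N k) (at x) w = w \<bullet> frechet_derivative (N k) (at x) v"
  shows "wedge_field c a N \<in> div_free_fields A \<omega>"
proof -
  let ?Z = "wedge_field c a N"
  have "compact (chart_inv c ` K)"
    using homeomorphism_cont2[OF chart_homeomorphism[OF atlas c]] K
    by (meson compact_continuous_image continuous_on_subset)
  \<comment> \<open>By the Hausdorff property. Its complement is thus open, and the field vanishes
    near each point outside the domain of \<open>c\<close>, including boundary points of that
    domain.\<close>
  then have closed: "closed (chart_inv c ` K)" by (rule compact_imp_closed)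
  have Z0: "?Z x = 0" if x: "x \<notin> chart_inv c ` K" for x
  proof (cases "x \<in> fst c")
    case True
    have "snd c x \<notin> K"
    proof
      assume "snd c x \<in> K"
      then have "chart_inv c (snd c x) \<in> chart_inv c ` K" by (rule imageI)
      with x show False by (simp add: chart_inv_chart[OF atlas c True])
    qed
    then have "wedge_coords a (\<lambda>k. N k (snd c x)) = 0"
      using supp \<open>b \<noteq> a\<close> by (intro wedge_coords_zero)
    moreover have "from_chart A c x 0 = 0"
      unfolding from_chart_eq
      by (rule linear_0[OF linear_transition_deriv[OF atlas c chart_at_mem(1)[OF atlas] True chart_at_mem(2)[OF atlas]]])
    ultimately show ?thesis by (simp add: wedge_field_def)
  qed (simp add: wedge_field_def)
  have local: "\<exists>T. open T \<and> y \<in> T \<and> Ck_on 1 T (loc_field A ?Z d) \<and> divergence A \<omega> ?Z d y = 0"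
    if d: "d \<in> A" and y: "y \<in> chart_image d" for d y
  proof (cases "chart_inv d y \<in> fst c")
    case True
    let ?O = "snd d ` (fst d \<inter> fst c)"
    define \<sigma> where "\<sigma> = snd c \<circ> chart_inv d"
    define R where "R k = (\<lambda>y. \<chi> j. N k (\<sigma> y) \<bullet> frechet_derivative \<sigma> (at y) (axis j 1))" for k
    have O: "open ?O" by (rule open_chart_overlap[OF atlas d c])
    have smooth: "smooth_on ?O \<sigma>" unfolding \<sigma>_def by (rule smooth_on_transition[OF atlas d c])
    have "snd d (chart_inv d y) \<in> ?O"
      using True chart_inv_mem[OF atlas d y] by simp
    then have yO: "y \<in> ?O" by (simp only: chart_chart_inv[OF atlas d y])
    have RC1: "Ck_on 1 ?O (R k)" for k
      by (rule pullback_closed_form(1)[OF N sym O smooth R_def])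
    have Rsym: "v \<bullet> frechet_derivative (R k) (at z) w = w \<bullet> frechet_derivative (R k) (at z) v"
      if "z \<in> ?O" for k z v w
      by (rule pullback_closed_form(2)[OF N sym O smooth R_def that])
    have sub: "?O \<subseteq> chart_image d" by (auto simp: chart_image_def)
    have loc: "density A \<omega> d z *\<^sub>R loc_field A ?Z d z = wedge_coords a (\<lambda>k. R k z)"
      and nz: "density A \<omega> d z \<noteq> 0" if z: "z \<in> ?O" for z
    proof -
      obtain x where x: "x \<in> fst d" "x \<in> fst c" "z = snd d x" using z by blast
      have "\<sigma> z = snd c x" by (simp add: \<sigma>_def x chart_inv_chart[OF atlas d])
      moreover have "frechet_derivative \<sigma> (at z) = transition_deriv d c x"
        by (simp add: \<sigma>_def x transition_deriv_def)
      ultimately show "density A \<omega> d z *\<^sub>R loc_field A ?Z d z = wedge_coords a (\<lambda>k. R k z)"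
        unfolding R_def using loc_field_wedge_field[OF c x(2) d x(1)] x(3) by simp
      show "density A \<omega> d z \<noteq> 0" using density_nonzero[OF d x(1)] x(3) by simp
    qed
    have W: "Ck_on 1 ?O (\<lambda>z. wedge_coords a (\<lambda>k. R k z))"
    proof (rule Ck_on_1_cartI)
      fix i
      have "Ck_on 1 ?O (\<lambda>z. (\<chi> k. if k = a then axis i 1 else R k z) $ k)" for k
      proof (cases "k = a")
        case True
        then show ?thesis using Ck_on_1_const by (simp del: One_nat_def)
      next
        case False
        then show ?thesis using RC1 by (simp del: One_nat_def)
      qed
      then have "Ck_on 1 ?O (\<lambda>z. det (\<chi> k. if k = a then axis i 1 else R k z))"
        by (rule Ck_on_1_det)
      then show "Ck_on 1 ?O (\<lambda>z. wedge_coords a (\<lambda>k. R k z) $ i)"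
        by (simp add: wedge_coords_def del: One_nat_def)
    qed
    have dens: "Ck_on 1 ?O (density A \<omega> d)"
      by (rule Ck_on_1_subset[OF Ck_on_1_density[OF atlas vol d] sub])
    have "Ck_on 1 ?O (\<lambda>z. inverse (density A \<omega> d z) *\<^sub>R wedge_coords a (\<lambda>k. R k z))"
      by (intro Ck_on_1_bounded_bilinear[OF bounded_bilinear_scaleR] Ck_on_1_inverse dens W nz)
    then have "Ck_on 1 ?O (loc_field A ?Z d)"
      by (rule Ck_on_1_cong[OF O]) (simp add: loc[symmetric] nz)
    moreover have "divergence A \<omega> ?Z d y = 0"
    proof -
      have "frechet_derivative (\<lambda>z. density A \<omega> d z * loc_field A ?Z d z $ i) (at y) =
          frechet_derivative (\<lambda>z. det (\<chi> k. if k = a then axis i 1 else R k z)) (at y)" for i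
      proof (rule frechet_derivative_cong_open[OF O yO])
        fix z assume "z \<in> ?O"
        from arg_cong[OF loc[OF this], of "\<lambda>v. v $ i"]
        show "density A \<omega> d z * loc_field A ?Z d z $ i = det (\<chi> k. if k = a then axis i 1 else R k z)"
          by (simp add: wedge_coords_def)
      qed
      then show ?thesis
        unfolding divergence_def
        using divergence_det_closed_rows[of a R "\<lambda>k. frechet_derivative (R k) (at y)" y]
          Ck_on_1D(1)[OF RC1 yO] Rsym[OF yO] by simp
    qed
    ultimately show ?thesis using O yO by (intro exI[of _ ?O] conjI)
  next
    case False
    let ?V = "snd d ` (fst d \<inter> - chart_inv c ` K)"
    have V: "open ?V" by (rule open_chart_preimage[OF atlas d open_Compl[OF closed]])
    have yV: "y \<in> ?V"
    proof -
      have "chart_inv d y \<notin> chart_inv c ` K"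
        using False chart_inv_mem[OF atlas c subsetD[OF K(2)]] by auto
      then have "snd d (chart_inv d y) \<in> ?V"
        by (intro imageI) (simp add: chart_inv_mem[OF atlas d y])
      then show ?thesis by (simp add: chart_chart_inv[OF atlas d y])
    qed
    have loc: "loc_field A ?Z d z = 0" if z: "z \<in> ?V" for z
    proof -
      obtain x where x: "x \<in> fst d" "x \<notin> chart_inv c ` K" "z = snd d x" using z by blast
      show ?thesis
        unfolding x(3) loc_field_chart[OF atlas d x(1)] Z0[OF x(2)]
        by (intro linear_0 linear_transition_deriv[OF atlas] chart_at_mem[OF atlas] d x(1))
    qed
    have "Ck_on 1 ?V (loc_field A ?Z d)"
      by (rule Ck_on_1_cong[OF V Ck_on_1_const]) (simp add: loc)
    moreover have "divergence A \<omega> ?Z d y = 0"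
    proof -
      have "frechet_derivative (\<lambda>z. density A \<omega> d z * loc_field A ?Z d z $ i) (at y) =
          frechet_derivative (\<lambda>z. 0) (at y)" for i
        by (rule frechet_derivative_cong_open[OF V yV]) (simp add: loc)
      then show ?thesis unfolding divergence_def by (simp add: frechet_derivative_const)
    qed
    ultimately show ?thesis using V yV by (intro exI[of _ ?V] conjI)
  qed
  have "Ck_on 1 (chart_image d) (loc_field A ?Z d)" if "d \<in> A" for d
  proof (rule Ck_on_1_local)
    fix y assume "y \<in> chart_image d"
    from local[OF that this] show "\<exists>T. open T \<and> y \<in> T \<and> Ck_on 1 T (loc_field A ?Z d)"
      by (elim ex_forward conjE) (intro conjI)
  qed
  moreover have "divergence A \<omega> ?Z d y = 0" if "d \<in> A" "y \<in> chart_image d" for d y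
    using local[OF that] by (elim exE conjE)
  ultimately show ?thesis unfolding div_free_fields_def C1_fields_def by simp
qed

lemma exists_div_free_field_with_zero:
  assumes "CARD('n) \<ge> 2"
  shows "\<exists>Z\<in>div_free_fields A \<omega>. (\<exists>x. Z x = 0) \<and> (\<exists>x. Z x \<noteq> 0)"
proof -
  \<comment> \<open>The covector of index \<open>a\<close> is left out of the product, that of index
    \<open>b\<close> is replaced by the cutoff form.\<close>
  obtain a b :: 'n where ab: "b \<noteq> a"
    using assms card_2_iff' ex_card[of 2 "UNIV :: 'n set"] by metis
  obtain p :: 'a where True by simp
  define c where "c = chart_at A p"
  note c = chart_at_mem[OF atlas, of p, folded c_def]
  define y0 where "y0 = snd c p"
  have "y0 \<in> chart_image c" unfolding y0_def by (rule chart_mem_image[OF atlas c(2)])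
  then obtain r where r: "r > 0" "cball y0 r \<subseteq> chart_image c"
    using open_chart_image[OF atlas c(1)] open_contains_cball by blast
  define q where "q x = r\<^sup>2 - (x - y0) \<bullet> (x - y0)" for x :: "real ^ 'n"
  \<comment> \<open>This is the gradient of \<open>- (max 0 (q x))^3 / 6\<close>, which is why the
    bilinear form given by \<open>\<Psi>'\<close> is symmetric.\<close>
  define \<Psi> where "\<Psi> x = (max 0 (q x))\<^sup>2 *\<^sub>R (x - y0)" for x
  define \<Psi>' where "\<Psi>' x v = (max 0 (q x))\<^sup>2 *\<^sub>R v - (4 * max 0 (q x) * ((x - y0) \<bullet> v)) *\<^sub>R (x - y0)" for x v
  define N where "N k = (if k = b then \<Psi> else (\<lambda>_. axis k 1))" for k
  have q': "(q has_derivative (\<lambda>v. - 2 * ((x - y0) \<bullet> v))) (at x)" for x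
    unfolding q_def by (auto intro!: derivative_eq_intros simp: inner_commute)
  have \<Psi>': "(\<Psi> has_derivative \<Psi>' x) (at x)" for x
  proof -
    have "((\<lambda>x. (max 0 (q x))\<^sup>2) has_derivative (\<lambda>v. - 2 * ((x - y0) \<bullet> v) * (2 * max 0 (q x)))) (at x)"
      using has_derivative_compose[OF q' has_real_derivative_max_0_squared[unfolded has_field_derivative_def]]
      by (simp add: mult_ac)
    from has_derivative_scaleR[OF this has_derivative_diff[OF has_derivative_ident has_derivative_const]]
    show ?thesis unfolding \<Psi>_def[abs_def]
      by (rule has_derivative_eq_rhs) (auto simp: \<Psi>'_def fun_eq_iff mult_ac)
  qed
  have "Ck_on 1 UNIV \<Psi>"
    by (rule Ck_on_1I[OF \<Psi>']) (auto simp: \<Psi>'_def q_def intro!: continuous_intros)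
  then have NC1: "Ck_on 1 UNIV (N k)" for k
    unfolding N_def using Ck_on_1_const by (cases "k = b") (simp_all del: One_nat_def)
  have \<Psi>_fd: "frechet_derivative \<Psi> (at x) = \<Psi>' x" for x
    by (rule frechet_derivative_at[OF \<Psi>', symmetric])
  have sym: "v \<bullet> frechet_derivative (N k) (at x) w = w \<bullet> frechet_derivative (N k) (at x) v" for k x v w
    by (cases "k = b")
       (simp_all add: N_def \<Psi>_fd \<Psi>'_def frechet_derivative_const inner_diff_right inner_commute mult_ac)
  have supp: "N b x = 0" if "x \<notin> cball y0 r" for x
  proof -
    have "r < norm (x - y0)" using that by (simp add: dist_norm norm_minus_commute)
    then have "r\<^sup>2 < (norm (x - y0))\<^sup>2" using r(1) by (intro power_strict_mono) auto
    then show ?thesis by (simp add: N_def \<Psi>_def q_def power2_norm_eq_inner)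
  qed
  let ?Z = "wedge_field c a N"
  have "?Z \<in> div_free_fields A \<omega>"
    by (rule wedge_field_div_free[where N = N, OF c(1) ab compact_cball r(2) supp NC1 sym])
  moreover have "?Z p = 0"
  proof -
    have "wedge_coords a (\<lambda>k. N k (snd c p)) = 0"
      by (rule wedge_coords_zero[OF ab]) (simp add: N_def \<Psi>_def y0_def)
    then show ?thesis
      using linear_0[OF linear_transition_deriv[OF atlas c(1) chart_at_mem(1)[OF atlas] c(2) chart_at_mem(2)[OF atlas]]]
      by (simp add: wedge_field_def from_chart_eq)
  qed
  moreover obtain x where "?Z x \<noteq> 0"
  proof -
    \<comment> \<open>Half a radius from the centre along the \<open>b\<close>-axis: there
      \<open>\<Psi>\<close> is a positive multiple of the basis vector \<open>axis b 1\<close>, and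
      the determinant for component \<open>a\<close> becomes diagonal.\<close>
    define y1 where "y1 = y0 + (r / 2) *\<^sub>R axis b 1"
    define x where "x = chart_inv c y1"
    have "y1 \<in> cball y0 r" using r(1) by (simp add: y1_def dist_norm)
    then have y1: "y1 \<in> chart_image c" using r(2) by blast
    have x: "x \<in> fst c" "snd c x = y1"
      unfolding x_def by (rule chart_inv_mem[OF atlas c(1) y1], rule chart_chart_inv[OF atlas c(1) y1])
    \<comment> \<open>At \<open>y1\<close> the cutoff argument is \<open>r^2 - r^2 / 4\<close>, and
      the displacement from the centre is \<open>r / 2\<close>.\<close>
    define s where "s = (3 / 4 * r\<^sup>2)\<^sup>2 * (r / 2)"
    have "q y1 = 3 / 4 * r\<^sup>2" by (simp add: q_def y1_def inner_axis_axis power2_eq_square field_simps)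
    moreover have "0 \<le> 3 / 4 * r\<^sup>2" by simp
    ultimately have "max 0 (q y1) = 3 / 4 * r\<^sup>2" by linarith
    moreover have "y1 - y0 = (r / 2) *\<^sub>R axis b 1" by (simp add: y1_def)
    ultimately have Nb: "N b y1 = s *\<^sub>R axis b 1" unfolding N_def \<Psi>_def s_def by simp
    have rows: "(\<chi> k. if k = a then axis a 1 else N k y1) = (\<chi> k. if k = b then s *\<^sub>R axis b 1 else axis k 1)"
      using ab Nb by (auto simp: vec_eq_iff N_def)
    have id: "(\<chi> k. if k = b then axis b 1 else axis k 1) = (mat 1 :: real ^ 'n ^ 'n)"
      by (simp add: vec_eq_iff mat_def axis_def)
    have "wedge_coords a (\<lambda>k. N k y1) $ a = s"
      using linear_scale[OF linear_det_row[of b "\<lambda>k. axis k 1"], of s "axis b 1"]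
      unfolding id by (simp add: wedge_coords_def rows)
    then have nz: "wedge_coords a (\<lambda>k. N k y1) \<noteq> 0" using r(1) by (auto simp: s_def)
    let ?w = "(1 / density A \<omega> c y1) *\<^sub>R wedge_coords a (\<lambda>k. N k y1)"
    have "?w \<noteq> 0" using nz density_nonzero[OF c(1) x(1)] x(2) by simp
    moreover have "?Z x = transition_deriv c (chart_at A x) x ?w"
      using x by (simp add: wedge_field_def from_chart_eq)
    moreover have "transition_deriv (chart_at A x) c x (transition_deriv c (chart_at A x) x ?w) = ?w"
      by (rule transition_deriv_inverse[OF atlas c(1) chart_at_mem(1)[OF atlas] x(1) chart_at_mem(2)[OF atlas]])
    moreover have "transition_deriv (chart_at A x) c x 0 = 0"
      by (intro linear_0 linear_transition_deriv[OF atlas] chart_at_mem[OF atlas] c(1) x(1))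
    ultimately have "?Z x \<noteq> 0" by metis
    then show ?thesis by (rule that)
  qed
  ultimately show ?thesis by blast
qed

end

section \<open>The boundary of the Anosov fields\<close>

theorem corollary1:
  fixes A :: "('a::t2_space, 'n::finite) chart set"
    and g :: "'a \<Rightarrow> real ^ 'n \<Rightarrow> real ^ 'n \<Rightarrow> real"
    and \<omega> :: "'a \<Rightarrow> real ^ 'n ^ 'n \<Rightarrow> real"
  assumes "CARD('n) \<ge> 4"
    and "closed_connected_manifold A"
    and "riemannian_metric A g"
    and "volume_form A \<omega>"
  shows "\<not> (\<exists>X\<in>div_free_fields A \<omega>. isolated_in_anosov_boundary A g \<omega> X)"
proof
  assume "\<exists>X\<in>div_free_fields A \<omega>. isolated_in_anosov_boundary A g \<omega> X"
  then obtain X U where X: "X \<in> div_free_fields A \<omega>" and not_anosov: "\<not> anosov A g X"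
    and U: "openin (div_free_topology A \<omega>) U" "X \<in> U"
    and near: "\<And>Y. Y \<in> U \<Longrightarrow> Y \<noteq> X \<Longrightarrow> anosov A g Y"
    unfolding isolated_in_anosov_boundary_def div_free_anosov_def by blast
  have atlas: "smooth_atlas A" using assms(2) unfolding closed_connected_manifold_def by blast
  obtain V where V: "openin (C1_topology A) V" "U = V \<inter> div_free_fields A \<omega>"
    using U(1) unfolding div_free_topology_def openin_subtopology by blast
  have C1: "Y \<in> C1_fields A" if "Y \<in> div_free_fields A \<omega>" for Y
    using that unfolding div_free_fields_def by blast
  \<comment> \<open>Positive \<open>s\<close> makes the neighbour different from \<open>X\<close>
    and keeps \<open>1 + s\<close> a positive factor. Being divergence-free is checked separately,
    since \<open>V\<close> is open among all C1 fields.\<close>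
  have line: "\<exists>s>0. (\<lambda>x. X x + s *\<^sub>R Z x) \<in> V" if "Z \<in> div_free_fields A \<omega>" for Z
  proof -
    have "\<forall>\<^sub>F s in nhds 0. (\<lambda>x. X x + s *\<^sub>R Z x) \<in> V"
      using eventually_line_in_openin[OF atlas C1[OF X] C1[OF that] V(1)] U(2) V(2) by blast
    then obtain d where "d > 0" "\<And>s. dist s 0 < d \<Longrightarrow> (\<lambda>x. X x + s *\<^sub>R Z x) \<in> V"
      unfolding eventually_nhds_metric by blast
    then show ?thesis by (intro exI[of _ "d / 2"]) simp
  qed
  show False
  \<comment> \<open>The zero field coincides with all its multiples, so rescaling yields no second
    field to which isolation could be applied.\<close>
  proof (cases "X = (\<lambda>_. 0)")
    case False
    obtain s where s: "s > 0" "(\<lambda>x. X x + s *\<^sub>R X x) \<in> V" using line[OF X] by blast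
    have eq: "(\<lambda>x. X x + s *\<^sub>R X x) = (\<lambda>x. (1 + s) *\<^sub>R X x)" by (simp add: scaleR_left_distrib)
    have "(\<lambda>x. (1 + s) *\<^sub>R X x) \<in> U"
      using s(2) div_free_fields_scale[OF atlas assms(4) X] unfolding V(2) eq by blast
    moreover have "(\<lambda>x. (1 + s) *\<^sub>R X x) \<noteq> X"
      unfolding eq[symmetric] using False s(1) by (auto simp: fun_eq_iff)
    ultimately have "anosov A g (\<lambda>x. (1 + s) *\<^sub>R X x)" by (rule near)
    then have "anosov A g X"
      using s(1) by (intro anosov_of_anosov_scale[OF atlas C1[OF X] assms(3), of "1 + s"]) auto
    with not_anosov show False ..
  next
    case True
    obtain Z x x' where Z: "Z \<in> div_free_fields A \<omega>" "Z x = 0" "Z x' \<noteq> 0"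
      using exists_div_free_field_with_zero[OF atlas assms(4)] assms(1) by auto
    obtain s where s: "s > 0" "(\<lambda>x. X x + s *\<^sub>R Z x) \<in> V" using line[OF Z(1)] by blast
    have "(\<lambda>x. s *\<^sub>R Z x) \<in> U"
      using s(2) div_free_fields_scale[OF atlas assms(4) Z(1)] True unfolding V(2) by simp
    moreover have "(\<lambda>x. s *\<^sub>R Z x) \<noteq> X" using True s(1) Z(3) by (auto simp: fun_eq_iff)
    ultimately have "anosov A g (\<lambda>x. s *\<^sub>R Z x)" by (rule near)
    \<comment> \<open>For an Anosov field the whole manifold is a regular set.\<close>
    then have "s *\<^sub>R Z x \<noteq> 0" unfolding anosov_def hyperbolic_set_def by blast
    with Z(2) show False by simp
  qed
qed

end
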